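(* Let $\Omega\subset\mathbb{C}$ be a bounded John domain, let $z_0\in\Omega$, let $1<p<\infty$, and let $m\ge1$ be an integer with $mp>\dim_{\mathrm A}(\partial\Omega)$. Let $N>m$ be an integer. Then there is a constant $C\ge1$, independent of $f$, such that every analytic function $f$ in $\Omega$ satisfies $$ C^{-1}\int_\Omega |f^{(m)}(z)|^p\delta(z)^{mp-2}\,dA(z) \le \sum_{k=m}^{N-1}|f^{(k)}(z_0)|^p\delta(z_0)^{kp}+\int_\Omega |f^{(N)}(z)|^p\delta(z)^{Np-2}\,dA(z) \le C\int_\Omega |f^{(m)}(z)|^p\delta(z)^{mp-2}\,dA(z). $$ In particular, if $m\ge2$, this holds on every bounded John domain without further boundary assumptions (that is, without assuming $mp>\dim_{\mathrm A}(\partial\Omega)$).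
   Context: $\delta(z)=\operatorname{dist}(z,\partial\Omega)$ is the Euclidean distance to the boundary and $dA=dx\,dy$ is Euclidean area measure. A domain is a nonempty connected open set. Inequalities involving possibly infinite integrals are understood in the extended sense (values in $[0,\infty]$). $f^{(k)}$ denotes the $k$-th complex derivative. John domain: a bounded domain $\Omega\subset\mathbb{C}$ is a John domain if there exist a point $x_0\in\Omega$ and a constant $C_J>0$ such that every $x\in\Omega$ can be joined to $x_0$ by a rectifiable curve $\gamma:[0,\ell]\to\Omega$, parametrized by arclength starting from $x$ (so $\gamma(0)=x$, $\gamma(\ell)=x_0$), with $\delta(\gamma(t))\ge C_J t$ for $0\le t\le \ell$. Assouad dimension: for $E\subset\mathbb{C}$, $\dim_{\mathrm A}(E)$ is the infimum of all exponents $s\ge0$ for which there is a constant $C>0$ such that $N_r(E\cap B(x,R))\le C(R/r)^s$ for all $x\in E$ and all $0<r<R$, where $B(x,R)$ is the open ball and $N_r(A)$ is the smallest number of open balls of radius $r$ needed to cover $A$. *)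

theory Defs
  imports "HOL-Analysis.Analysis"
begin

definition bdist :: "complex set \<Rightarrow> complex \<Rightarrow> real" where
  "bdist \<Omega> z = infdist z (frontier \<Omega>)"

(* Supremum of the lengths of the polygons inscribed along finite partitions
   a = t 0 \<le> ... \<le> t n = b; infinite exactly for non-rectifiable curves. *)
definition curve_length :: "(real \<Rightarrow> complex) \<Rightarrow> real \<Rightarrow> real \<Rightarrow> ennreal" where
  "curve_length \<gamma> a b =
     (SUP (n, t) \<in> {(n :: nat, t :: nat \<Rightarrow> real).
                       t 0 = a \<and> t n = b \<and> (\<forall>i<n. t i \<le> t (Suc i))}.
        \<Sum>i<n. ennreal (dist (\<gamma> (t i)) (\<gamma> (t (Suc i)))))"

(* Rectifiability is part of the condition, since all lengths are required to be finite. *)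
definition arclength_parametrized :: "(real \<Rightarrow> complex) \<Rightarrow> real \<Rightarrow> bool" where
  "arclength_parametrized \<gamma> l \<longleftrightarrow>
     continuous_on {0..l} \<gamma> \<and> (\<forall>t\<in>{0..l}. curve_length \<gamma> 0 t = ennreal t)"

definition bounded_john_domain :: "complex set \<Rightarrow> bool" where
  "bounded_john_domain \<Omega> \<longleftrightarrow>
     open \<Omega> \<and> connected \<Omega> \<and> \<Omega> \<noteq> {} \<and> bounded \<Omega> \<and>
     (\<exists>x0\<in>\<Omega>. \<exists>C_J>0. \<forall>x\<in>\<Omega>. \<exists>l\<ge>0. \<exists>\<gamma>.
        arclength_parametrized \<gamma> l \<and> \<gamma> ` {0..l} \<subseteq> \<Omega> \<and> \<gamma> 0 = x \<and> \<gamma> l = x0 \<and>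
        (\<forall>t\<in>{0..l}. bdist \<Omega> (\<gamma> t) \<ge> C_J * t))"

(* The centres of the balls are not required to lie in A. *)
definition covering_number :: "real \<Rightarrow> complex set \<Rightarrow> enat" where
  "covering_number r A =
     (INF X \<in> {X. finite X \<and> A \<subseteq> (\<Union>x\<in>X. ball x r)}. enat (card X))"

definition assouad_dim :: "complex set \<Rightarrow> ereal" where
  "assouad_dim E = Inf {ereal s | s. 0 \<le> s \<and>
     (\<exists>C>0. \<forall>x\<in>E. \<forall>r R. 0 < r \<and> r < R \<longrightarrow>
        ereal_of_enat (covering_number r (E \<inter> ball x R)) \<le> ereal (C * (R / r) powr s))}"

definition deriv_integral :: "complex set \<Rightarrow> real \<Rightarrow> nat \<Rightarrow> (complex \<Rightarrow> complex) \<Rightarrow> ennreal" where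
  "deriv_integral \<Omega> p k f =
     (\<integral>\<^sup>+z\<in>\<Omega>. ennreal (cmod ((deriv ^^ k) f z) powr p * bdist \<Omega> z powr (real k * p - 2)) \<partial>lborel)"

end

(* Everything reduces to one step, comparing g = f^(k) with its derivative.  Bounding the derivative by
   the function is the mean value inequality on discs of radius comparable to delta, plus Fubini.

   For the converse, integrate g' along the John curve from x to the centre x0 and replace |g'| at each
   point by its mean over a disc of radius delta/2.  Since delta grows linearly along the curve, these
   discs lie in the cone S(x) = {y. |x - y| <= K delta(y)}, and Fubini gives
     |g(x) - g(x0)| <= A * (integral over S(x) of |g'| / delta).
   Jensen's inequality for the measure delta^(-sigma-2) dA, which has mass at most a multiple of
   delta(x)^(-sigma) on S(x), and a second use of Fubini reduce the weighted bound to
     (integral of delta^beta over a ball of radius R centred on the boundary) <= C R^(beta+2),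
   and this follows from the covering bound when beta + 2 exceeds an admissible Assouad exponent.
   Any planar set has Assouad exponent 2, and m p > 2 as soon as m >= 2. *)
theory Submission
  imports Defs "HOL-Complex_Analysis.Complex_Analysis"
begin

section \<open>Mean value inequalities\<close>

text \<open>Two obstacles shape the proof: no integral of \<open>g\<close> or \<open>g'\<close> is
  known to be finite, and a John curve is merely 1-Lipschitz. All estimates therefore live in
  \<open>ennreal\<close>, where only finite terms are cancelled, and increments of \<open>g\<close>
  along a curve are bounded by bisection of the parameter interval instead of a path integral. The
  parameter sigma comes from the splitting |g'| / delta = (|g'| delta^(sigma+1)) * delta^(-sigma-2).
  It must be positive so that the dyadic layers of a cone have geometrically decaying mass. It must
  also satisfy sigma (p-1) < a + 2 - s, because Fubini leaves the weight delta^beta with beta = a -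
  sigma (p-1), and its integral near the boundary is controlled when beta + 2 > s. The strict
  inequality between m p and the dimension opens this window. The step from order k to k+1 has a = k
  p - 2 and asks for k p > s, which every k \<ge> m inherits from m. The John condition brings its
  own centre x0, so the values of g at x0 and at the prescribed z0 have to be compared
  separately.\<close>

lemma measurable_Complex [measurable]: "(\<lambda>(x, y). Complex x y) \<in> borel \<Otimes>\<^sub>M borel \<rightarrow>\<^sub>M borel"
proof -
  have "(\<lambda>(x, y). Complex x y) = (\<lambda>p. complex_of_real (fst p) + \<i> * complex_of_real (snd p))"
    by (auto simp: complex_eq_iff)
  then show ?thesis by (simp only:) measurable
qed

text \<open>\<open>lborel\<close> is determined by its values on boxes, and a box pulls back under
  \<open>Complex\<close> to a product of two intervals.\<close>

lemma lborel_complex: "lborel = distr (lborel \<Otimes>\<^sub>M lborel) borel (\<lambda>(x, y). Complex x y)"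
proof (rule lborel_eqI)
  fix l u :: complex
  assume le: "\<And>b. b \<in> Basis \<Longrightarrow> l \<bullet> b \<le> u \<bullet> b"
  have lr: "Re l \<le> Re u" "Im l \<le> Im u"
    using le[of 1] le[of \<i>] by (auto simp: Basis_complex_def)
  have vi: "(\<lambda>(x, y). Complex x y) -` box l u = {Re l<..<Re u} \<times> {Im l<..<Im u}"
    by (auto simp: in_box_complex_iff)
  show "emeasure (distr (lborel \<Otimes>\<^sub>M lborel) borel (\<lambda>(x, y). Complex x y)) (box l u) = (\<Prod>b\<in>Basis. (u - l) \<bullet> b)"
    using lr by (subst emeasure_distr)
      (auto simp: vi space_pair_measure Basis_complex_def lborel.emeasure_pair_measure_Times ennreal_mult'
        measurable_cong_sets[OF sets_pair_measure_cong[OF sets_lborel sets_lborel] refl])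
qed simp

lemma nn_integral_complex:
  assumes [measurable]: "F \<in> borel_measurable borel"
  shows "(\<integral>\<^sup>+z. F z \<partial>lborel) = (\<integral>\<^sup>+x. \<integral>\<^sup>+y. F (Complex x y) \<partial>lborel \<partial>lborel)"
proof -
  have [measurable]: "(\<lambda>(x, y). Complex x y) \<in> lborel \<Otimes>\<^sub>M lborel \<rightarrow>\<^sub>M borel"
    using measurable_Complex by (simp cong: measurable_cong_sets)
  have m: "(\<lambda>p. F (case p of (x, y) \<Rightarrow> Complex x y)) \<in> borel_measurable (lborel \<Otimes>\<^sub>M lborel)"
    by measurable
  have "(\<integral>\<^sup>+z. F z \<partial>lborel) = (\<integral>\<^sup>+p. F (case p of (x, y) \<Rightarrow> Complex x y) \<partial>(lborel \<Otimes>\<^sub>M lborel))"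
    by (subst lborel_complex) (simp add: nn_integral_distr)
  also have "\<dots> = (\<integral>\<^sup>+x. \<integral>\<^sup>+y. F (Complex x y) \<partial>lborel \<partial>lborel)"
    using lborel.nn_integral_fst[OF m] by simp
  finally show ?thesis .
qed

text \<open>A quarter turn exchanges the coordinates and reflects one of them, so Fubini and the
  one-dimensional reflection suffice.\<close>

lemma nn_integral_times_ii:
  assumes [measurable]: "F \<in> borel_measurable borel"
  shows "(\<integral>\<^sup>+z. F (\<i> * z) \<partial>lborel) = (\<integral>\<^sup>+z. F z \<partial>lborel)"
proof -
  have C: "Complex = (\<lambda>x y. complex_of_real x + \<i> * complex_of_real y)"
    by (auto simp: fun_eq_iff complex_eq_iff)
  have [measurable]: "(\<lambda>y. F (Complex (- y) x)) \<in> borel_measurable borel"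
    "(\<lambda>y. F (Complex y x)) \<in> borel_measurable borel" for x
    unfolding C by measurable
  have m2: "(\<lambda>(x, y). F (Complex y x)) \<in> borel_measurable (lborel \<Otimes>\<^sub>M lborel)"
    unfolding C by measurable
  have "(\<integral>\<^sup>+z. F (\<i> * z) \<partial>lborel) = (\<integral>\<^sup>+x. \<integral>\<^sup>+y. F (Complex (- y) x) \<partial>lborel \<partial>lborel)"
    by (subst nn_integral_complex) (auto simp: complex_eq_iff intro!: nn_integral_cong arg_cong[where f=F])
  also have "\<dots> = (\<integral>\<^sup>+x. \<integral>\<^sup>+y. F (Complex y x) \<partial>lborel \<partial>lborel)"
  proof (rule nn_integral_cong)
    fix x :: real
    show "(\<integral>\<^sup>+y. F (Complex (- y) x) \<partial>lborel) = (\<integral>\<^sup>+y. F (Complex y x) \<partial>lborel)"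
      using nn_integral_real_affine[of "\<lambda>y. F (Complex y x)" "-1" 0] by simp
  qed
  also have "\<dots> = (\<integral>\<^sup>+y. \<integral>\<^sup>+x. F (Complex y x) \<partial>lborel \<partial>lborel)"
    by (rule lborel_pair.Fubini'[OF m2, symmetric])
  also have "\<dots> = (\<integral>\<^sup>+z. F z \<partial>lborel)"
    by (rule nn_integral_complex[symmetric]) simp
  finally show ?thesis .
qed

text \<open>The four sides of a square arise from its right-hand side by these quarter turns; after
  averaging over the size, each side contributes the same planar integral.\<close>

lemma nn_integral_fourth_root:
  assumes [measurable]: "F \<in> borel_measurable borel" and u: "u \<in> {1, \<i>, -1, -\<i>}"
  shows "(\<integral>\<^sup>+w. F (z + u * w) \<partial>lborel) = (\<integral>\<^sup>+w. F w \<partial>lborel)"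
proof -
  have tr: "(\<integral>\<^sup>+w. F (z + w) \<partial>lborel) = (\<integral>\<^sup>+w. F w \<partial>lborel)"
    by (subst (2) lborel_distr_plus[of z, symmetric]) (simp add: nn_integral_distr)
  have i1: "(\<integral>\<^sup>+w. F (z + \<i> * w) \<partial>lborel) = (\<integral>\<^sup>+w. F (z + w) \<partial>lborel)"
    by (rule nn_integral_times_ii[of "\<lambda>w. F (z + w)"]) simp
  have i2: "(\<integral>\<^sup>+w. F (z - w) \<partial>lborel) = (\<integral>\<^sup>+w. F (z + \<i> * w) \<partial>lborel)"
    using nn_integral_times_ii[of "\<lambda>w. F (z + \<i> * w)"] by (simp flip: mult.assoc)
  have i3: "(\<integral>\<^sup>+w. F (z - \<i> * w) \<partial>lborel) = (\<integral>\<^sup>+w. F (z - w) \<partial>lborel)"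
    using nn_integral_times_ii[of "\<lambda>w. F (z - w)"] by simp
  show ?thesis using u i1 i2 i3 tr by auto
qed

text \<open>The mean value inequality over discs is derived from Cauchy's formula on squares rather than
  circles: averaging over the size of the square then needs only Fubini in Cartesian coordinates.\<close>

lemma square_side_bound:
  fixes g :: "complex \<Rightarrow> complex"
  assumes g: "continuous_on (ball z (2 * r)) g" and \<rho>: "0 < \<rho>" "\<rho> \<le> r" and u: "u \<in> {1, \<i>, -1, -\<i>}"
    and I: "((\<lambda>w. g w / (w - z)) has_contour_integral I) (linepath (z + u * Complex \<rho> (-\<rho>)) (z + u * Complex \<rho> \<rho>))"
  shows "ennreal (\<rho> * cmod I) \<le> (\<integral>\<^sup>+y. ennreal (cmod (g (z + u * Complex \<rho> y)) * indicator (ball z (2 * r)) (z + u * Complex \<rho> y)) \<partial>lborel)"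
proof -
  have nu: "cmod u = 1" using u by auto
  let ?l = "\<lambda>t. z + u * Complex \<rho> (\<rho> * (2 * t - 1))"
  have C: "Complex = (\<lambda>x y. complex_of_real x + \<i> * complex_of_real y)"
    by (auto simp: fun_eq_iff complex_eq_iff)
  \<comment> \<open>The farthest points of the side are the corners, at distance sqrt 2 * \<rho> < 2
    * \<rho>; hence the radius \<open>2 * r\<close> of the ball.\<close>
  have inb: "?l t \<in> ball z (2 * r)" if "t \<in> {0..1}" for t
  proof -
    have "(2 * t - 1)\<^sup>2 \<le> 1" using that by (intro abs_square_le_1[THEN iffD2]) auto
    then have "\<rho>\<^sup>2 + (\<rho> * (2 * t - 1))\<^sup>2 \<le> 2 * \<rho>\<^sup>2"
      using mult_left_mono[of "(2 * t - 1)\<^sup>2" 1 "\<rho>\<^sup>2"] by (simp add: power_mult_distrib)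
    also have "\<dots> < (2 * \<rho>)\<^sup>2" using \<rho> by (simp add: power2_eq_square)
    finally have "cmod (Complex \<rho> (\<rho> * (2 * t - 1))) < 2 * \<rho>"
      unfolding complex_norm using \<rho> by (metis (no_types, lifting) abs_of_pos complex.sel mult_pos_pos real_sqrt_abs real_sqrt_less_mono zero_less_numeral)
    with \<rho> show ?thesis by (simp add: dist_norm norm_mult nu)
  qed
  have lp: "linepath (z + u * Complex \<rho> (-\<rho>)) (z + u * Complex \<rho> \<rho>) t = ?l t" for t
    by (simp add: linepath_def C scaleR_conv_of_real algebra_simps)
  define h where "h t = g (?l t) / (?l t - z) * (u * (2 * \<rho> * \<i>))" for t
  have "((\<lambda>t. g (?l t) / (?l t - z) * (z + u * Complex \<rho> \<rho> - (z + u * Complex \<rho> (-\<rho>)))) has_integral I) {0..1}"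
    using I unfolding has_contour_integral_linepath lp by simp
  also have "(\<lambda>t. g (?l t) / (?l t - z) * (z + u * Complex \<rho> \<rho> - (z + u * Complex \<rho> (-\<rho>)))) = h"
    by (simp add: h_def C fun_eq_iff algebra_simps)
  finally have hI: "(h has_integral I) {0..1}" .
  have contl: "continuous_on {0..1} ?l" unfolding C by (intro continuous_intros)
  have contg: "continuous_on {0..1} (\<lambda>t. g (?l t))"
    by (rule continuous_on_compose2[OF g contl]) (use inb in auto)
  have cn: "continuous_on {0..1} (\<lambda>t. cmod (g (?l t)))"
    by (intro continuous_intros contg)
  \<comment> \<open>The velocity has modulus 2 * \<rho>, while the distance to \<open>z\<close> is
    at least \<rho>.\<close>
  have hb: "cmod (h t) \<le> 2 * cmod (g (?l t))" for t
  proof -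
    let ?n = "cmod (Complex \<rho> (\<rho> * (2 * t - 1)))"
    have n: "\<rho> \<le> ?n"
      using abs_Re_le_cmod[of "Complex \<rho> (\<rho> * (2 * t - 1))"] \<rho> by simp
    then have n1: "\<rho> / ?n \<le> 1" using \<rho> by (subst divide_le_eq_1_pos) linarith+
    have "cmod (h t) = cmod (g (?l t)) * (\<rho> / ?n) * 2"
      using \<rho> nu by (auto simp: h_def norm_mult norm_divide)
    also have "\<dots> \<le> cmod (g (?l t)) * 1 * 2"
      using n1 by (intro mult_right_mono mult_left_mono) auto
    finally show ?thesis by simp
  qed
  have "cmod I \<le> integral {0..1} (\<lambda>t. 2 * cmod (g (?l t)))"
    using integral_norm_bound_integral[of h "{0..1}" "\<lambda>t. 2 * cmod (g (?l t))"] hb hI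
      integrable_continuous_interval[OF continuous_on_mult_left[OF cn, of 2]]
    by (simp add: has_integral_integrable_integral)
  also have "\<dots> = 2 * integral {0..1} (\<lambda>t. cmod (g (?l t)))" by simp
  finally have le: "cmod I \<le> 2 * integral {0..1} (\<lambda>t. cmod (g (?l t)))" .
  \<comment> \<open>Extension by zero outside the ball turns the bound into an integral over a whole
    line, ready for Fubini in \<rho> and y.\<close>
  let ?F = "\<lambda>w. cmod (g w) * indicator (ball z (2 * r)) w"
  have mF: "?F \<in> borel_measurable borel"
  proof -
    have "(\<lambda>w. indicator (ball z (2 * r)) w *\<^sub>R cmod (g w)) \<in> borel_measurable borel"
      by (intro borel_measurable_continuous_on_indicator continuous_intros g) simp
    then show ?thesis by (simp add: mult.commute)
  qed
  have [measurable]: "(\<lambda>y. ?F (z + u * Complex \<rho> y)) \<in> borel_measurable borel"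
    unfolding C by (rule measurable_compose[OF _ mF]) measurable
  have "ennreal (integral {0..1} (\<lambda>t. cmod (g (?l t)))) = (\<integral>\<^sup>+t. ennreal (indicator {0..1} t * cmod (g (?l t))) \<partial>lborel)"
  proof (rule nn_integral_has_integral_lborel[symmetric])
    have "(\<lambda>t. indicator {0..1} t *\<^sub>R cmod (g (?l t))) \<in> borel_measurable borel"
      by (intro borel_measurable_continuous_on_indicator cn) simp
    then show "(\<lambda>t. indicator {0..1} t * cmod (g (?l t))) \<in> borel_measurable borel" by simp
    have "((\<lambda>t. cmod (g (?l t))) has_integral (integral {0..1} (\<lambda>t. cmod (g (?l t))))) {0..1}"
      using integrable_continuous_interval[OF cn] by blast
    then show "((\<lambda>t. indicator {0..1} t * cmod (g (?l t))) has_integral (integral {0..1} (\<lambda>t. cmod (g (?l t))))) UNIV"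
      by (subst (asm) has_integral_restrict_UNIV[symmetric])
        (erule back_subst[where P="\<lambda>f. (f has_integral _) _"], auto simp: indicator_def)
  qed auto
  also have "\<dots> \<le> (\<integral>\<^sup>+t. ennreal (?F (z + u * Complex \<rho> ((-\<rho>) + 2 * \<rho> * t))) \<partial>lborel)"
    using inb by (intro nn_integral_mono ennreal_leI) (auto simp: indicator_def algebra_simps)
  finally have le2: "ennreal (integral {0..1} (\<lambda>t. cmod (g (?l t)))) \<le> \<dots>" .
  have "ennreal (\<rho> * cmod I) \<le> ennreal (2 * \<rho>) * ennreal (integral {0..1} (\<lambda>t. cmod (g (?l t))))"
    using \<rho> le by (subst ennreal_mult'[symmetric]) (auto intro!: ennreal_leI)
  also have "\<dots> \<le> ennreal (2 * \<rho>) * (\<integral>\<^sup>+t. ennreal (?F (z + u * Complex \<rho> ((-\<rho>) + 2 * \<rho> * t))) \<partial>lborel)"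
    by (rule mult_left_mono[OF le2]) simp
  also have "\<dots> = (\<integral>\<^sup>+y. ennreal (?F (z + u * Complex \<rho> y)) \<partial>lborel)"
    using \<rho> by (subst nn_integral_real_affine[where c="2 * \<rho>" and t="-\<rho>"]) auto
  finally show ?thesis by simp
qed

text \<open>Cauchy's formula on the square of half-side \<rho> expresses 2 pi i g(z) by four side
  integrals; \<open>square_side_bound\<close> controls each of them after multiplication by
  \<rho>.\<close>

lemma square_mean_value:
  fixes g :: "complex \<Rightarrow> complex"
  assumes g: "g holomorphic_on ball z (2 * r)" and \<rho>: "0 < \<rho>" "\<rho> \<le> r"
  shows "ennreal (2 * \<rho> * cmod (g z)) \<le> (\<Sum>u\<in>{1, \<i>, -1, -\<i>}. \<integral>\<^sup>+y. ennreal (cmod (g (z + u * Complex \<rho> y)) * indicator (ball z (2 * r)) (z + u * Complex \<rho> y)) \<partial>lborel)"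
proof -
  define side where "side u = linepath (z + u * Complex \<rho> (-\<rho>)) (z + u * Complex \<rho> \<rho>)" for u
  define h where "h w = g w / (w - z)" for w
  define \<gamma> where "\<gamma> = rectpath (z - Complex \<rho> \<rho>) (z + Complex \<rho> \<rho>)"
  \<comment> \<open>\<open>rectpath\<close> starts at the lower left corner, so the bottom side, u =
    -i, comes first.\<close>
  have \<gamma>: "\<gamma> = side (-\<i>) +++ side 1 +++ side \<i> +++ side (-1)"
    by (simp add: \<gamma>_def rectpath_def side_def Let_def)
      (intro arg_cong2[where f=joinpaths] arg_cong2[where f=linepath]; simp add: complex_eq_iff)
  have ends: "pathfinish (side (-\<i>)) = pathstart (side 1)" "pathfinish (side 1) = pathstart (side \<i>)"
    "pathfinish (side \<i>) = pathstart (side (-1))"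
    by (simp_all add: side_def complex_eq_iff)
  have zbox: "z \<in> box (z - Complex \<rho> \<rho>) (z + Complex \<rho> \<rho>)"
    using \<rho> by (simp add: in_box_complex_iff)
  have sub: "path_image \<gamma> \<subseteq> ball z (2 * r) - {z}"
  proof
    fix w assume "w \<in> path_image \<gamma>"
    then have w: "w \<in> cbox (z - Complex \<rho> \<rho>) (z + Complex \<rho> \<rho>)" "w \<noteq> z"
      using path_image_rectpath_cbox_minus_box[of "z - Complex \<rho> \<rho>" "z + Complex \<rho> \<rho>"] \<rho> zbox
      by (auto simp: \<gamma>_def)
    then have "\<bar>Re (w - z)\<bar> \<le> \<rho>" "\<bar>Im (w - z)\<bar> \<le> \<rho>"
      by (auto simp: in_cbox_complex_iff abs_le_iff)
    then have "(cmod (w - z))\<^sup>2 \<le> \<rho>\<^sup>2 + \<rho>\<^sup>2"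
      unfolding cmod_power2 by (intro add_mono) (auto simp: abs_le_square_iff[symmetric] \<rho>)
    also have "\<dots> < (2 * \<rho>)\<^sup>2" using \<rho> by (simp add: power2_eq_square)
    finally have "cmod (w - z) < 2 * \<rho>" by (rule power2_less_imp_less) (use \<rho> in simp)
    with \<rho> w show "w \<in> ball z (2 * r) - {z}" by (simp add: dist_norm norm_minus_commute)
  qed
  have "(h has_contour_integral (2 * pi * \<i> * winding_number \<gamma> z * g z)) \<gamma>"
    unfolding h_def using \<rho> g sub
    by (intro Cauchy_integral_formula_convex_simple[where S="ball z (2 * r)"])
      (auto simp: \<gamma>_def)
  moreover have "winding_number \<gamma> z = 1"
    unfolding \<gamma>_def by (rule winding_number_rectpath[OF zbox])
  ultimately have I: "(h has_contour_integral (2 * pi * \<i> * g z)) \<gamma>" by simp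
  have conth: "continuous_on (ball z (2 * r) - {z}) h"
    unfolding h_def
    by (intro continuous_intros continuous_on_subset[OF holomorphic_on_imp_continuous_on[OF g]]) auto
  have int: "h contour_integrable_on side u" if "u \<in> {1, \<i>, -1, -\<i>}" for u
  proof -
    have "path_image (side u) \<subseteq> path_image \<gamma>"
      using that by (auto simp: \<gamma> path_image_join ends)
    then have "continuous_on (path_image (side u)) h"
      using sub conth continuous_on_subset by blast
    then show ?thesis by (simp add: side_def contour_integrable_continuous_linepath)
  qed
  define J where "J u = contour_integral (side u) h" for u
  have hJ: "(h has_contour_integral J u) (side u)" if "u \<in> {1, \<i>, -1, -\<i>}" for u
    using int[OF that] by (simp add: J_def has_contour_integral_integral)
  have "(h has_contour_integral (J (-\<i>) + (J 1 + (J \<i> + J (-1))))) \<gamma>"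
    unfolding \<gamma> by (intro has_contour_integral_join hJ valid_path_join) (auto simp: ends, auto simp: side_def)
  with I have eq: "2 * pi * \<i> * g z = J (-\<i>) + (J 1 + (J \<i> + J (-1)))"
    by (rule has_contour_integral_unique)
  have "2 * cmod (g z) \<le> 2 * pi * cmod (g z)"
    using pi_gt3 by (intro mult_right_mono) auto
  also have "\<dots> = cmod (J (-\<i>) + (J 1 + (J \<i> + J (-1))))"
    by (simp flip: eq add: norm_mult)
  also have "\<dots> \<le> (\<Sum>u\<in>{1, \<i>, -1, -\<i>}. cmod (J u))"
    using norm_triangle_ineq[of "J (-\<i>)" "J 1 + (J \<i> + J (-1))"] norm_triangle_ineq[of "J 1" "J \<i> + J (-1)"]
      norm_triangle_ineq[of "J \<i>" "J (-1)"] by (simp add: complex_eq_iff)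
  finally have "2 * \<rho> * cmod (g z) \<le> (\<Sum>u\<in>{1, \<i>, -1, -\<i>}. \<rho> * cmod (J u))"
    using \<rho> by (simp flip: sum_distrib_left)
  then have "ennreal (2 * \<rho> * cmod (g z)) \<le> (\<Sum>u\<in>{1, \<i>, -1, -\<i>}. ennreal (\<rho> * cmod (J u)))"
    using \<rho> by (subst sum_ennreal) (auto intro: ennreal_leI)
  also have "\<dots> \<le> (\<Sum>u\<in>{1, \<i>, -1, -\<i>}. \<integral>\<^sup>+y. ennreal (cmod (g (z + u * Complex \<rho> y)) * indicator (ball z (2 * r)) (z + u * Complex \<rho> y)) \<partial>lborel)"
    using hJ g \<rho> unfolding h_def side_def
    by (intro sum_mono square_side_bound holomorphic_on_imp_continuous_on)
  finally show ?thesis .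
qed

lemma borel_measurable_indicator_norm:
  fixes g :: "complex \<Rightarrow> complex"
  assumes "continuous_on S g" "S \<in> sets borel"
  shows "(\<lambda>w. cmod (g w) * indicator S w) \<in> borel_measurable borel"
proof -
  have "(\<lambda>w. indicator S w *\<^sub>R cmod (g w)) \<in> borel_measurable borel"
    by (intro borel_measurable_continuous_on_indicator continuous_intros assms)
  then show ?thesis by (simp add: mult.commute)
qed

text \<open>\<open>square_mean_value\<close> is integrated over the half-side \<rho>. Each of the
  four sides then yields at most the full planar integral, and 32 / r^2 is 4 * (2 / s^2) with s = r
  / 2.\<close>

lemma area_mean_value:
  fixes g :: "complex \<Rightarrow> complex"
  assumes g: "g holomorphic_on ball z r" and r: "0 < r"
  shows "ennreal (cmod (g z)) \<le> ennreal (32 / r\<^sup>2) * (\<integral>\<^sup>+w. ennreal (cmod (g w) * indicator (ball z r) w) \<partial>lborel)"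
proof -
  define s where "s = r / 2"
  have s: "0 < s" "r = 2 * s" using r by (auto simp: s_def)
  define F where "F w = ennreal (cmod (g w) * indicator (ball z r) w)" for w
  have mF [measurable]: "F \<in> borel_measurable borel"
    using borel_measurable_indicator_norm[OF holomorphic_on_imp_continuous_on[OF g]] unfolding F_def by measurable
  have C: "Complex = (\<lambda>x y. complex_of_real x + \<i> * complex_of_real y)"
    by (auto simp: fun_eq_iff complex_eq_iff)
  have [measurable]: "(\<lambda>\<rho>. \<integral>\<^sup>+y. F (z + u * Complex \<rho> y) \<partial>lborel) \<in> borel_measurable borel" for u
    unfolding C by measurable
  \<comment> \<open>On [s/2, s] the factor 2 * \<rho> is at least s, and the length s/2 of the
    interval produces s^2 / 2.\<close>
  have "ennreal (s\<^sup>2 / 2 * cmod (g z)) = (\<integral>\<^sup>+\<rho>. ennreal (s * cmod (g z)) * indicator {s/2..s} \<rho> \<partial>lborel)"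
    using s by (subst nn_integral_cmult_indicator) (auto simp: ennreal_mult'[symmetric] power2_eq_square)
  also have "\<dots> \<le> (\<integral>\<^sup>+\<rho>. (\<Sum>u\<in>{1, \<i>, -1, -\<i>}. \<integral>\<^sup>+y. F (z + u * Complex \<rho> y) \<partial>lborel) \<partial>lborel)"
  proof (rule nn_integral_mono)
    fix \<rho> :: real
    show "ennreal (s * cmod (g z)) * indicator {s/2..s} \<rho> \<le> (\<Sum>u\<in>{1, \<i>, -1, -\<i>}. \<integral>\<^sup>+y. F (z + u * Complex \<rho> y) \<partial>lborel)"
    proof (cases "\<rho> \<in> {s/2..s}")
      case True
      then have "ennreal (s * cmod (g z)) * indicator {s/2..s} \<rho> \<le> ennreal (2 * \<rho> * cmod (g z))"
        by (auto intro!: ennreal_leI mult_right_mono)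
      also have "\<dots> \<le> (\<Sum>u\<in>{1, \<i>, -1, -\<i>}. \<integral>\<^sup>+y. F (z + u * Complex \<rho> y) \<partial>lborel)"
        using square_mean_value[of g z s \<rho>] g s True unfolding F_def by auto
      finally show ?thesis .
    qed simp
  qed
  also have "\<dots> = (\<Sum>u\<in>{1, \<i>, -1, -\<i>}. \<integral>\<^sup>+\<rho>. \<integral>\<^sup>+y. F (z + u * Complex \<rho> y) \<partial>lborel \<partial>lborel)"
    by (rule nn_integral_sum) simp
  also have "\<dots> = (\<Sum>u\<in>{1, \<i>, -1, -\<i>}. integral\<^sup>N lborel F)"
    by (rule sum.cong) (auto simp: nn_integral_complex[of "\<lambda>w. F (z + _ * w)", symmetric] nn_integral_fourth_root)
  also have "\<dots> = 4 * integral\<^sup>N lborel F"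
    by (simp add: complex_eq_iff)
  finally have *: "ennreal (s\<^sup>2 / 2 * cmod (g z)) \<le> 4 * integral\<^sup>N lborel F" .
  have "ennreal (cmod (g z)) = ennreal (2 / s\<^sup>2) * ennreal (s\<^sup>2 / 2 * cmod (g z))"
    using s by (simp add: ennreal_mult'[symmetric] field_simps)
  also have "\<dots> \<le> ennreal (2 / s\<^sup>2) * (4 * integral\<^sup>N lborel F)"
    by (rule mult_left_mono[OF *]) simp
  also have "\<dots> = ennreal (2 / s\<^sup>2 * 4) * integral\<^sup>N lborel F"
    by (subst ennreal_mult) (auto simp: mult.assoc)
  also have "2 / s\<^sup>2 * 4 = 32 / r\<^sup>2"
    using s by (simp add: power_mult_distrib)
  finally show ?thesis by (simp add: F_def)
qed

section \<open>Jensen's inequality and mean values of p-th powers\<close>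

text \<open>Convexity of t^p as a bound by the tangent at c. Being linear in t, it can be integrated
  without knowing that the integral of the p-th power is finite.\<close>

lemma powr_tangent_bound:
  fixes t c p :: real
  assumes p: "1 < p" and c: "0 < c" and t: "0 \<le> t"
  shows "p * c powr (p - 1) * t \<le> t powr p + (p - 1) * c powr p"
proof -
  let ?q = "p / (p - 1)"
  have "t * c powr (p - 1) \<le> t powr p / p + (c powr (p - 1)) powr ?q / ?q"
    using p c t by (intro Youngs_inequality) (auto simp: field_simps)
  also have "(c powr (p - 1)) powr ?q = c powr p"
    using p by (simp add: powr_powr)
  finally show ?thesis using p by (simp add: field_simps)
qed

text \<open>Jensen for a measure of mass at most \<open>M\<close>, not normalised, and for a lower
  bound \<open>t\<close> of the integral. The tangent inequality is taken at c = t / M and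
  integrated; this choice gives c^p * M = c^(p-1) * t, so the two linear terms combine.\<close>

lemma nn_integral_powr_Jensen:
  fixes u w :: "'a \<Rightarrow> real"
  assumes p: "1 < p" and M: "0 < M" and t: "0 \<le> t"
    and [measurable]: "u \<in> borel_measurable N" "w \<in> borel_measurable N"
    and u: "\<And>x. 0 \<le> u x" and w: "\<And>x. 0 \<le> w x"
    and W: "(\<integral>\<^sup>+x. ennreal (w x) \<partial>N) \<le> ennreal M"
    and tle: "ennreal t \<le> (\<integral>\<^sup>+x. ennreal (u x * w x) \<partial>N)"
  shows "ennreal (t powr p) \<le> ennreal (M powr (p - 1)) * (\<integral>\<^sup>+x. ennreal (u x powr p * w x) \<partial>N)"
proof (cases "t = 0")
  case False
  define c where "c = t / M"
  have c: "0 < c" using M t False by (simp add: c_def)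
  define J where "J = (\<integral>\<^sup>+x. ennreal (u x powr p * w x) \<partial>N)"
  have cM: "c powr p * M = c powr (p - 1) * t"
    using c M t by (simp add: c_def powr_diff)
  have "ennreal (p * c powr (p - 1) * t) \<le> ennreal (p * c powr (p - 1)) * (\<integral>\<^sup>+x. ennreal (u x * w x) \<partial>N)"
    using p by (subst ennreal_mult) (auto intro!: mult_left_mono tle t)
  also have "\<dots> = (\<integral>\<^sup>+x. ennreal (p * c powr (p - 1) * u x * w x) \<partial>N)"
    using p u w by (subst nn_integral_cmult[symmetric]) (auto simp: ennreal_mult'[symmetric] mult.assoc)
  also have "\<dots> \<le> (\<integral>\<^sup>+x. ennreal (u x powr p * w x) + ennreal ((p - 1) * c powr p) * ennreal (w x) \<partial>N)"
  proof (rule nn_integral_mono)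
    fix x
    have "p * c powr (p - 1) * u x * w x \<le> (u x powr p + (p - 1) * c powr p) * w x"
      by (intro mult_right_mono powr_tangent_bound p c u w)
    then show "ennreal (p * c powr (p - 1) * u x * w x) \<le> ennreal (u x powr p * w x) + ennreal ((p - 1) * c powr p) * ennreal (w x)"
      using p w[of x] by (simp add: ennreal_mult'[symmetric] ennreal_plus[symmetric] distrib_right del: ennreal_plus)
  qed
  also have "\<dots> = J + ennreal ((p - 1) * c powr p) * (\<integral>\<^sup>+x. ennreal (w x) \<partial>N)"
    by (simp add: nn_integral_add nn_integral_cmult J_def)
  also have "\<dots> \<le> J + ennreal ((p - 1) * c powr p) * ennreal M"
    by (intro add_left_mono mult_left_mono W) simp
  also have "ennreal ((p - 1) * c powr p) * ennreal M = ennreal ((p - 1) * (c powr (p - 1) * t))"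
    using p M cM by (simp add: ennreal_mult'[symmetric] mult.assoc)
  finally have "ennreal (p * c powr (p - 1) * t) \<le> J + ennreal ((p - 1) * (c powr (p - 1) * t))" .
  moreover have "p * c powr (p - 1) * t = c powr (p - 1) * t + (p - 1) * (c powr (p - 1) * t)"
    by (simp add: algebra_simps)
  then have "ennreal (p * c powr (p - 1) * t) = ennreal (c powr (p - 1) * t) + ennreal ((p - 1) * (c powr (p - 1) * t))"
    using p t by (simp only: ennreal_plus mult_nonneg_nonneg powr_ge_zero diff_ge_0_iff_ge less_imp_le)
  \<comment> \<open>The cancelled term is a real number, so this is sound even when \<open>J\<close>
    is infinite.\<close>
  ultimately have *: "ennreal (c powr (p - 1) * t) \<le> J"
    by (metis add.commute ennreal_add_left_cancel_le ennreal_neq_top infinity_ennreal_def)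
  have "t powr p = M powr (p - 1) * (c powr (p - 1) * t)"
    using M t False by (simp add: c_def powr_divide powr_diff)
  then have "ennreal (t powr p) = ennreal (M powr (p - 1)) * ennreal (c powr (p - 1) * t)"
    using t by (simp add: ennreal_mult'[symmetric])
  also have "\<dots> \<le> ennreal (M powr (p - 1)) * J"
    by (rule mult_left_mono[OF *]) simp
  finally show ?thesis by (simp add: J_def)
qed simp

lemma emeasure_ball_complex:
  fixes x :: complex
  assumes "0 \<le> r"
  shows "emeasure lborel (ball x r) = ennreal (pi * r\<^sup>2)" "emeasure lborel (cball x r) = ennreal (pi * r\<^sup>2)"
  using assms by (auto simp: emeasure_ball emeasure_cball unit_ball_vol_2)

text \<open>Jensen applied to the weight 32 / r^2 on the disc, whose mass 32 * pi does not depend on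
  r. The constant serves all \<open>g\<close>, \<open>z\<close> and \<open>r\<close> at once, as the
  later integration over \<open>z\<close> demands.\<close>

lemma mean_value_powr:
  fixes p :: real
  assumes p: "1 < p"
  obtains C where "0 < C"
    "\<And>g z r. 0 < r \<Longrightarrow> g holomorphic_on ball z r \<Longrightarrow>
        ennreal (cmod (g z) powr p) \<le> ennreal (C * r powr (-2)) * (\<integral>\<^sup>+w. ennreal (cmod (g w) powr p * indicator (ball z r) w) \<partial>lborel)"
proof -
  define C0 where "C0 = (32 * pi) powr (p - 1) * 32"
  have C0: "0 < C0" by (simp add: C0_def)
  define I where "I g z r = (\<integral>\<^sup>+w. ennreal (cmod (g w) powr p * indicator (ball z r) w) \<partial>lborel)" for g :: "complex \<Rightarrow> complex" and z r
  have e1: "ennreal (cmod (g z) powr p) \<le> ennreal (C0 * r powr (-2)) * I g z r"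
    if r: "0 < r" and g: "g holomorphic_on ball z r" for g z r
  proof -
    have r2: "r powr (-2) = 1 / r\<^sup>2" using r by (simp add: powr_minus_divide powr_numeral)
    define u where "u w = cmod (g w) * indicator (ball z r) w" for w
    define W where "W w = 32 / r\<^sup>2 * indicator (ball z r) w" for w :: complex
    have mu [measurable]: "u \<in> borel_measurable borel"
      using borel_measurable_indicator_norm[OF holomorphic_on_imp_continuous_on[OF g]] unfolding u_def by simp
    have mW [measurable]: "W \<in> borel_measurable borel" unfolding W_def by (intro borel_measurable_times borel_measurable_const borel_measurable_indicator borel_open) simp
    have "ennreal (cmod (g z) powr p) \<le> ennreal ((32 * pi) powr (p - 1)) * (\<integral>\<^sup>+w. ennreal (u w powr p * W w) \<partial>lborel)"
    proof (rule nn_integral_powr_Jensen[OF p])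
      have "(\<integral>\<^sup>+w. ennreal (W w) \<partial>lborel) = (\<integral>\<^sup>+w. ennreal (32 / r\<^sup>2) * indicator (ball z r) w \<partial>lborel)"
        by (intro nn_integral_cong) (auto simp: W_def indicator_def)
      also have "\<dots> = ennreal (32 * pi)"
        using r by (subst nn_integral_cmult_indicator)
          (auto simp: emeasure_ball_complex ennreal_mult'[symmetric] power2_eq_square)
      finally show "(\<integral>\<^sup>+w. ennreal (W w) \<partial>lborel) \<le> ennreal (32 * pi)" by simp
      have "ennreal (cmod (g z)) \<le> ennreal (32 / r\<^sup>2) * (\<integral>\<^sup>+w. ennreal (u w) \<partial>lborel)"
        using area_mean_value[OF g r] by (simp add: u_def)
      also have "\<dots> = (\<integral>\<^sup>+w. ennreal (32 / r\<^sup>2) * ennreal (u w) \<partial>lborel)"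
        by (rule nn_integral_cmult[symmetric]) measurable
      also have "\<dots> = (\<integral>\<^sup>+w. ennreal (u w * W w) \<partial>lborel)"
        by (intro nn_integral_cong) (auto simp: ennreal_mult'[symmetric] u_def W_def indicator_def)
      finally show "ennreal (cmod (g z)) \<le> \<dots>" .
      show "0 \<le> u w" "0 \<le> W w" for w by (simp_all add: u_def W_def)
    qed (simp_all add: mu mW)
    also have "(\<integral>\<^sup>+w. ennreal (u w powr p * W w) \<partial>lborel) = (\<integral>\<^sup>+w. ennreal (32 / r\<^sup>2) * ennreal (cmod (g w) powr p * indicator (ball z r) w) \<partial>lborel)"
      by (intro nn_integral_cong) (auto simp: u_def W_def indicator_def ennreal_mult'[symmetric])
    also have "\<dots> = ennreal (32 / r\<^sup>2) * I g z r"
    proof -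
      have "(\<lambda>w. u w powr p) \<in> borel_measurable borel" by measurable
      also have "(\<lambda>w. u w powr p) = (\<lambda>w. cmod (g w) powr p * indicator (ball z r) w)"
        by (auto simp: u_def indicator_def)
      finally show ?thesis unfolding I_def by (intro nn_integral_cmult) simp
    qed
    finally show ?thesis
      by (simp add: r2 C0_def mult.assoc[symmetric] ennreal_mult'[symmetric])
  qed
  show ?thesis by (rule that[OF C0 e1[unfolded I_def]])
qed

text \<open>Cauchy's estimate on the circle of radius r/2: around each of its points a disc of
  radius r/2 still fits into the given disc, so \<open>mean_value_powr\<close> bounds
  \<open>g\<close> there.\<close>

lemma deriv_mean_value_powr:
  fixes p :: real
  assumes p: "1 < p"
  obtains C where "0 < C"
    "\<And>g z r. 0 < r \<Longrightarrow> g holomorphic_on ball z r \<Longrightarrow>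
        ennreal (cmod (deriv g z) powr p) \<le> ennreal (C * r powr (-2-p)) * (\<integral>\<^sup>+w. ennreal (cmod (g w) powr p * indicator (ball z r) w) \<partial>lborel)"
proof -
  obtain C0 where C0: "0 < C0" and e1: "\<And>g z r. 0 < r \<Longrightarrow> g holomorphic_on ball z r \<Longrightarrow>
        ennreal (cmod (g z) powr p) \<le> ennreal (C0 * r powr (-2)) * (\<integral>\<^sup>+w. ennreal (cmod (g w) powr p * indicator (ball z r) w) \<partial>lborel)"
    by (rule mean_value_powr[OF p]) blast
  define I where "I g z r = (\<integral>\<^sup>+w. ennreal (cmod (g w) powr p * indicator (ball z r) w) \<partial>lborel)" for g :: "complex \<Rightarrow> complex" and z r
  have e2: "ennreal (cmod (deriv g z) powr p) \<le> ennreal (C0 * 4 * 2 powr p * r powr (-2-p)) * I g z r"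
    if r: "0 < r" and g: "g holomorphic_on ball z r" for g z r
  \<comment> \<open>Cauchy's estimate asks for a real bound on the circle, which exists only when
    the integral is finite; otherwise the right-hand side is infinite.\<close>
  proof (cases "I g z r = top")
    case True
    have "C0 * 4 * 2 powr p * r powr (-2-p) > 0" using C0 r by simp
    then show ?thesis using C0 r by (simp add: True ennreal_mult_top)
  next
    case False
    then obtain J where J: "0 \<le> J" "I g z r = ennreal J" by (cases "I g z r") auto
    define X where "X = C0 * 4 * r powr (-2) * J"
    have X: "0 \<le> X" using C0 J by (simp add: X_def)
    have "cmod (g x) \<le> X powr (1 / p)" if x: "cmod (z - x) = r / 2" for x
    proof -
      have sub: "ball x (r / 2) \<subseteq> ball z r" using x by (simp add: ball_subset_ball_iff dist_norm norm_minus_commute)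
      have "ennreal (cmod (g x) powr p) \<le> ennreal (C0 * (r / 2) powr (-2)) * I g x (r / 2)"
        unfolding I_def using r sub g by (intro e1) (auto intro: holomorphic_on_subset)
      also have "\<dots> \<le> ennreal (C0 * (r / 2) powr (-2)) * I g z r"
        unfolding I_def using sub by (intro mult_left_mono nn_integral_mono ennreal_leI) (auto simp: indicator_def)
      also have "(r / 2) powr (-2) = 4 * r powr (-2)"
        using r by (simp add: powr_minus_divide powr_numeral power_divide)
      also have "ennreal (C0 * (4 * r powr (-2))) * I g z r = ennreal X"
        using C0 by (simp add: J X_def ennreal_mult'[symmetric] mult.assoc)
      finally have "cmod (g x) powr p \<le> X" using X by simp
      then have "(cmod (g x) powr p) powr (1 / p) \<le> X powr (1 / p)"
        using p by (intro powr_mono2) auto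
      then show ?thesis using p by (simp add: powr_powr)
    qed
    then have "cmod ((deriv ^^ 1) g z) \<le> fact 1 * X powr (1 / p) / (r / 2) ^ 1"
      using r g by (intro Cauchy_inequality)
        (auto intro: holomorphic_on_subset intro!: continuous_on_subset[OF holomorphic_on_imp_continuous_on[OF g]])
    then have "cmod (deriv g z) \<le> X powr (1 / p) * (2 / r)" using r by simp
    then have "cmod (deriv g z) powr p \<le> (X powr (1 / p) * (2 / r)) powr p"
      using p by (intro powr_mono2) auto
    also have "\<dots> = X * (2 powr p / r powr p)"
      using p r X by (simp add: powr_mult powr_powr powr_divide)
    also have "\<dots> = C0 * 4 * 2 powr p * r powr (-2-p) * J"
      using r by (simp add: X_def powr_diff powr_minus field_simps)
    finally show ?thesis using C0 J by (simp add: ennreal_mult'[symmetric])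
  qed
  show ?thesis by (rule that[OF _ e2[unfolded I_def]]) (use C0 in simp)
qed

section \<open>Distance to the boundary\<close>

lemma ennreal_mult_ennreal_mult: "0 \<le> a \<Longrightarrow> ennreal a * (ennreal b * X) = ennreal (a * b) * X"
  by (simp add: ennreal_mult' mult.assoc)

text \<open>The absolute value in the exponent of \<open>K\<close> treats positive and negative
  powers alike; the exponents of the weights can have either sign.\<close>

lemma powr_le_of_comparable:
  fixes x y a :: real
  assumes K: "1 \<le> K" and xy: "0 < x" "0 < y" "x \<le> K * y" "y \<le> K * x"
  shows "x powr a \<le> K powr \<bar>a\<bar> * y powr a"
proof (cases "0 \<le> a")
  case True
  then have "x powr a \<le> (K * y) powr a" using xy by (intro powr_mono2) auto
  then show ?thesis using True K xy by (simp add: powr_mult)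
next
  case False
  have "y powr (-a) \<le> (K * x) powr (-a)" using xy False by (intro powr_mono2) auto
  also have "\<dots> = K powr (-a) * x powr (-a)" using K xy by (simp add: powr_mult)
  finally show ?thesis using False xy K by (simp add: powr_minus field_simps)
qed

lemma bdist_Lipschitz: "\<bar>bdist \<Omega> x - bdist \<Omega> y\<bar> \<le> dist x y"
  unfolding bdist_def by (rule infdist_triangle_abs)

lemma bdist_nonneg [simp]: "0 \<le> bdist \<Omega> x"
  by (simp add: bdist_def infdist_nonneg)

lemma continuous_on_bdist [continuous_intros]: "continuous_on S (bdist \<Omega>)"
  unfolding bdist_def by (intro continuous_intros)

lemma borel_measurable_bdist [measurable]: "bdist \<Omega> \<in> borel_measurable borel"
  by (intro borel_measurable_continuous_onI continuous_on_bdist)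

lemma frontier_bounded_open_nonempty:
  fixes \<Omega> :: "complex set"
  assumes "bounded \<Omega>" "\<Omega> \<noteq> {}"
  shows "frontier \<Omega> \<noteq> {}"
  using assms by (intro frontier_not_empty) auto

lemma bdist_attained:
  assumes "bounded \<Omega>" "\<Omega> \<noteq> {}"
  obtains w where "w \<in> frontier \<Omega>" "bdist \<Omega> x = dist x w"
  using infdist_attains_inf[OF frontier_closed frontier_bounded_open_nonempty[OF assms]]
  unfolding bdist_def by metis

lemma bdist_pos:
  assumes "open \<Omega>" "bounded \<Omega>" "x \<in> \<Omega>"
  shows "0 < bdist \<Omega> x"
proof -
  obtain w where w: "w \<in> frontier \<Omega>" "bdist \<Omega> x = dist x w"
    using bdist_attained[of \<Omega> x] assms by auto
  then have "w \<noteq> x" using assms by (auto simp: frontier_def interior_open)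
  then show ?thesis by (simp add: w)
qed

text \<open>A disc centred in the domain that left it would be a connected set meeting the frontier,
  closer to the centre than the distance allows.\<close>

lemma ball_bdist_subset:
  assumes "open \<Omega>" "x \<in> \<Omega>"
  shows "ball x (bdist \<Omega> x) \<subseteq> \<Omega>"
proof (rule ccontr)
  assume n: "\<not> ?thesis"
  then have "0 < bdist \<Omega> x" by (metis ball_eq_empty empty_subsetI not_le)
  then have "ball x (bdist \<Omega> x) \<inter> frontier \<Omega> \<noteq> {}"
    using n assms by (intro connected_Int_frontier) (use \<open>0 < bdist \<Omega> x\<close> centre_in_ball in blast)+
  then obtain w where "w \<in> frontier \<Omega>" "dist x w < bdist \<Omega> x" by auto
  then show False unfolding bdist_def using infdist_le[of w "frontier \<Omega>" x] by simp
qed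

lemma bdist_comparable:
  assumes "dist x y \<le> bdist \<Omega> x / 2"
  shows "bdist \<Omega> x \<le> 2 * bdist \<Omega> y" "bdist \<Omega> y \<le> 2 * bdist \<Omega> x"
  using assms bdist_Lipschitz[of \<Omega> x y] bdist_nonneg[of \<Omega> x] by linarith+

section \<open>Bounding the derivative and point values by the function\<close>

text \<open>The cone relation between x and y describes a cone in y for fixed x, but a disc around y
  for fixed y. Both uses of Fubini between points of the plane go through this exchange.\<close>

lemma Tonelli_cone:
  assumes [measurable]: "h \<in> borel_measurable borel" "k \<in> borel_measurable borel"
  shows "(\<integral>\<^sup>+x. k x * (\<integral>\<^sup>+y. h y * indicator {y. dist x y \<le> K * bdist \<Omega> y} y \<partial>lborel) \<partial>lborel)
       = (\<integral>\<^sup>+y. h y * (\<integral>\<^sup>+x. k x * indicator (cball y (K * bdist \<Omega> y)) x \<partial>lborel) \<partial>lborel)"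
proof -
  define F :: "complex \<Rightarrow> complex \<Rightarrow> ennreal" where "F x y = (if dist x y \<le> K * bdist \<Omega> y then k x * h y else 0)" for x y
  have [measurable]: "(\<lambda>y. F x y) \<in> borel_measurable borel" "(\<lambda>x. F x y) \<in> borel_measurable borel" for x y
    unfolding F_def by measurable
  have mF: "case_prod F \<in> borel_measurable (lborel \<Otimes>\<^sub>M lborel)"
    unfolding F_def by measurable
  have "(\<integral>\<^sup>+x. k x * (\<integral>\<^sup>+y. h y * indicator {y. dist x y \<le> K * bdist \<Omega> y} y \<partial>lborel) \<partial>lborel)
      = (\<integral>\<^sup>+x. \<integral>\<^sup>+y. F x y \<partial>lborel \<partial>lborel)"
    by (intro nn_integral_cong, subst nn_integral_cmult[symmetric])
      (auto simp: F_def indicator_def intro!: nn_integral_cong)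
  also have "\<dots> = (\<integral>\<^sup>+y. \<integral>\<^sup>+x. F x y \<partial>lborel \<partial>lborel)"
    by (rule lborel_pair.Fubini'[OF mF, symmetric])
  also have "\<dots> = (\<integral>\<^sup>+y. h y * (\<integral>\<^sup>+x. k x * indicator (cball y (K * bdist \<Omega> y)) x \<partial>lborel) \<partial>lborel)"
    by (intro nn_integral_cong, subst nn_integral_cmult[symmetric])
      (auto simp: F_def indicator_def dist_commute mult.commute intro!: nn_integral_cong)
  finally show ?thesis .
qed

text \<open>With a = k p - 2 and g the k-th derivative this is \<open>deriv_integral\<close>. A free
  real exponent makes passing to the next derivative the shift from a to a + p.\<close>

definition weighted_integral :: "complex set \<Rightarrow> real \<Rightarrow> real \<Rightarrow> (complex \<Rightarrow> complex) \<Rightarrow> ennreal" where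
  "weighted_integral \<Omega> p a g =
     (\<integral>\<^sup>+z. ennreal (cmod (g z) powr p * bdist \<Omega> z powr a * indicator \<Omega> z) \<partial>lborel)"

text \<open>Outside the domain \<open>g\<close> is arbitrary, so measurability is first shown with
  the indicator inside the power; the two forms agree because \<open>0 powr p = 0\<close>.\<close>

lemma borel_measurable_weighted:
  assumes "open \<Omega>" "g holomorphic_on \<Omega>"
  shows "(\<lambda>z. cmod (g z) powr p * bdist \<Omega> z powr a * indicator \<Omega> z) \<in> borel_measurable borel"
proof -
  have [measurable]: "(\<lambda>z. cmod (g z) * indicator \<Omega> z) \<in> borel_measurable borel"
    using assms by (intro borel_measurable_indicator_norm holomorphic_on_imp_continuous_on) auto
  have "(\<lambda>z. (cmod (g z) * indicator \<Omega> z) powr p * bdist \<Omega> z powr a) \<in> borel_measurable borel" by measurable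
  also have "(\<lambda>z. (cmod (g z) * indicator \<Omega> z) powr p * bdist \<Omega> z powr a) = (\<lambda>z. cmod (g z) powr p * bdist \<Omega> z powr a * indicator \<Omega> z)"
    by (auto simp: indicator_def)
  finally show ?thesis .
qed

lemma weighted_integral_deriv_le:
  assumes \<Omega>: "open \<Omega>" "bounded \<Omega>" and p: "1 < p"
  obtains C where "0 < C" "\<And>g. g holomorphic_on \<Omega> \<Longrightarrow>
    weighted_integral \<Omega> p (a + p) (deriv g) \<le> ennreal C * weighted_integral \<Omega> p a g"
proof -
  obtain C0 where C0: "0 < C0"
    and est: "\<And>g z r. 0 < r \<Longrightarrow> g holomorphic_on ball z r \<Longrightarrow>
        ennreal (cmod (deriv g z) powr p) \<le> ennreal (C0 * r powr (-2-p)) * (\<integral>\<^sup>+w. ennreal (cmod (g w) powr p * indicator (ball z r) w) \<partial>lborel)"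
    by (rule deriv_mean_value_powr[OF p]) blast
  \<comment> \<open>The disc has radius d / 2, which gives 2^(2+p); the last factor pays for
    replacing delta(z) by delta(w) inside it.\<close>
  define C1 where "C1 = C0 * 2 powr (2 + p) * 2 powr \<bar>a - 2\<bar>"
  have C1: "0 < C1" using C0 by (simp add: C1_def)
  show ?thesis
  proof (rule that[of "C1 * pi"])
    show "0 < C1 * pi" using C1 by simp
    fix g assume g: "g holomorphic_on \<Omega>"
    \<comment> \<open>The exponent is two below a: the area of the disc of admissible z around w
      returns delta(w)^2.\<close>
    define h where "h w = ennreal (cmod (g w) powr p * bdist \<Omega> w powr (a - 2) * indicator \<Omega> w)" for w
    have [measurable]: "h \<in> borel_measurable borel"
      using borel_measurable_weighted[OF \<Omega>(1) g] unfolding h_def by measurable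
    have "weighted_integral \<Omega> p (a + p) (deriv g)
        \<le> (\<integral>\<^sup>+z. ennreal C1 * (\<integral>\<^sup>+w. h w * indicator {w. dist z w \<le> 1 * bdist \<Omega> w} w \<partial>lborel) \<partial>lborel)"
      unfolding weighted_integral_def
    proof (rule nn_integral_mono)
      fix z
      show "ennreal (cmod (deriv g z) powr p * bdist \<Omega> z powr (a + p) * indicator \<Omega> z)
        \<le> ennreal C1 * (\<integral>\<^sup>+w. h w * indicator {w. dist z w \<le> 1 * bdist \<Omega> w} w \<partial>lborel)"
      proof (cases "z \<in> \<Omega>")
        case True
        define d where "d = bdist \<Omega> z"
        have d: "0 < d" unfolding d_def by (rule bdist_pos[OF \<Omega> True])
        have "ball z (d / 2) \<subseteq> ball z d" using d by (intro subset_ball) auto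
        then have sub: "ball z (d / 2) \<subseteq> \<Omega>" using ball_bdist_subset[OF \<Omega>(1) True] unfolding d_def by blast
        have "ennreal (cmod (deriv g z) powr p * d powr (a + p))
            = ennreal (d powr (a + p)) * ennreal (cmod (deriv g z) powr p)"
          by (simp add: ennreal_mult'[symmetric] mult.commute)
        also have "\<dots> \<le> ennreal (d powr (a + p)) * (ennreal (C0 * (d / 2) powr (-2-p)) *
            (\<integral>\<^sup>+w. ennreal (cmod (g w) powr p * indicator (ball z (d / 2)) w) \<partial>lborel))"
          using d g sub by (intro mult_left_mono est) (auto intro: holomorphic_on_subset)
        also have "\<dots> = ennreal (C0 * 2 powr (2 + p) * d powr (a - 2)) *
            (\<integral>\<^sup>+w. ennreal (cmod (g w) powr p * indicator (ball z (d / 2)) w) \<partial>lborel)"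
        proof -
          have "(d / 2) powr (-2-p) = 2 powr (2 + p) * d powr (-2-p)"
            using d by (simp add: powr_divide powr_minus[of _ "2+p", simplified] field_simps)
          moreover have "d powr (a + p) * d powr (-2-p) = d powr (a - 2)"
            by (simp add: powr_add[symmetric])
          ultimately have "d powr (a + p) * (C0 * (d / 2) powr (-2-p)) = C0 * 2 powr (2 + p) * d powr (a - 2)"
            by (simp add: algebra_simps)
          then show ?thesis by (simp only: ennreal_mult_ennreal_mult powr_ge_zero)
        qed
        also have "\<dots> = (\<integral>\<^sup>+w. ennreal (C0 * 2 powr (2 + p) * d powr (a - 2)) * ennreal (cmod (g w) powr p * indicator (ball z (d / 2)) w) \<partial>lborel)"
        proof (rule nn_integral_cmult[symmetric])
          have "(\<lambda>w. (cmod (g w) * indicator (ball z (d / 2)) w) powr p) \<in> borel_measurable borel"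
            using borel_measurable_indicator_norm[OF holomorphic_on_imp_continuous_on[OF holomorphic_on_subset[OF g sub]]]
            by measurable
          also have "(\<lambda>w. (cmod (g w) * indicator (ball z (d / 2)) w) powr p) = (\<lambda>w. cmod (g w) powr p * indicator (ball z (d / 2)) w)"
            by (auto simp: indicator_def)
          finally show "(\<lambda>w. ennreal (cmod (g w) powr p * indicator (ball z (d / 2)) w)) \<in> borel_measurable lborel" by measurable
        qed
        also have "\<dots> \<le> (\<integral>\<^sup>+w. ennreal C1 * (h w * indicator {w. dist z w \<le> 1 * bdist \<Omega> w} w) \<partial>lborel)"
        proof (rule nn_integral_mono)
          fix w
          show "ennreal (C0 * 2 powr (2 + p) * d powr (a - 2)) * ennreal (cmod (g w) powr p * indicator (ball z (d / 2)) w)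
             \<le> ennreal C1 * (h w * indicator {w. dist z w \<le> 1 * bdist \<Omega> w} w)"
          proof (cases "w \<in> ball z (d / 2)")
            case w: True
            then have wo: "w \<in> \<Omega>" using sub by auto
            have dw: "d \<le> 2 * bdist \<Omega> w" "bdist \<Omega> w \<le> 2 * d"
              using bdist_comparable[of z w \<Omega>] w unfolding d_def by auto
            have "d powr (a - 2) \<le> 2 powr \<bar>a - 2\<bar> * bdist \<Omega> w powr (a - 2)"
              using d dw by (intro powr_le_of_comparable) auto
            then have "C0 * 2 powr (2 + p) * d powr (a - 2) * cmod (g w) powr p \<le> C0 * 2 powr (2 + p) * (2 powr \<bar>a - 2\<bar> * bdist \<Omega> w powr (a - 2)) * cmod (g w) powr p"
              using C0 by (intro mult_right_mono mult_left_mono) auto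
            moreover have "dist z w \<le> bdist \<Omega> w" using w dw by auto
            ultimately show ?thesis
              using w wo C1 by (simp add: h_def ennreal_mult'[symmetric] C1_def algebra_simps ennreal_leI)
          qed simp
        qed
        also have "\<dots> = ennreal C1 * (\<integral>\<^sup>+w. h w * indicator {w. dist z w \<le> 1 * bdist \<Omega> w} w \<partial>lborel)"
          by (rule nn_integral_cmult) measurable
        finally show ?thesis using True by (simp add: d_def)
      qed simp
    qed
    also have "\<dots> = (\<integral>\<^sup>+w. h w * (\<integral>\<^sup>+z. ennreal C1 * indicator (cball w (1 * bdist \<Omega> w)) z \<partial>lborel) \<partial>lborel)"
      by (rule Tonelli_cone) measurable
    also have "\<dots> = (\<integral>\<^sup>+w. ennreal (C1 * pi) * ennreal (cmod (g w) powr p * bdist \<Omega> w powr a * indicator \<Omega> w) \<partial>lborel)"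
    proof (rule nn_integral_cong)
      fix w
      have "(\<integral>\<^sup>+z. ennreal C1 * indicator (cball w (1 * bdist \<Omega> w)) z \<partial>lborel) = ennreal (C1 * pi * (bdist \<Omega> w)\<^sup>2)"
        using C1 by (subst nn_integral_cmult_indicator) (auto simp: emeasure_ball_complex ennreal_mult'[symmetric] mult.assoc)
      moreover have "bdist \<Omega> w powr a = bdist \<Omega> w powr (a - 2) * (bdist \<Omega> w)\<^sup>2" if "w \<in> \<Omega>"
        using bdist_pos[OF \<Omega> that] by (simp add: powr_diff powr_numeral)
      ultimately show "h w * (\<integral>\<^sup>+z. ennreal C1 * indicator (cball w (1 * bdist \<Omega> w)) z \<partial>lborel)
         = ennreal (C1 * pi) * ennreal (cmod (g w) powr p * bdist \<Omega> w powr a * indicator \<Omega> w)"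
        using C1 by (auto simp: h_def ennreal_mult'[symmetric] indicator_def algebra_simps)
    qed
    also have "\<dots> = ennreal (C1 * pi) * weighted_integral \<Omega> p a g"
      unfolding weighted_integral_def using borel_measurable_weighted[OF \<Omega>(1) g]
      by (intro nn_integral_cmult) simp
    finally show "weighted_integral \<Omega> p (a + p) (deriv g) \<le> ennreal (C1 * pi) * weighted_integral \<Omega> p a g" .
  qed
qed

lemma point_le_weighted_integral:
  assumes \<Omega>: "open \<Omega>" "bounded \<Omega>" and p: "1 < p" and z: "z \<in> \<Omega>"
  obtains C where "0 < C" "\<And>g. g holomorphic_on \<Omega> \<Longrightarrow>
    ennreal (cmod (g z) powr p) \<le> ennreal C * weighted_integral \<Omega> p a g"
proof -
  obtain C0 where C0: "0 < C0"
    and est: "\<And>g z r. 0 < r \<Longrightarrow> g holomorphic_on ball z r \<Longrightarrow>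
        ennreal (cmod (g z) powr p) \<le> ennreal (C0 * r powr (-2)) * (\<integral>\<^sup>+w. ennreal (cmod (g w) powr p * indicator (ball z r) w) \<partial>lborel)"
    by (rule mean_value_powr[OF p]) blast
  define d where "d = bdist \<Omega> z"
  have d: "0 < d" unfolding d_def by (rule bdist_pos[OF \<Omega> z])
  have "ball z (d / 2) \<subseteq> ball z d" using d by (intro subset_ball) auto
  then have sub: "ball z (d / 2) \<subseteq> \<Omega>" using ball_bdist_subset[OF \<Omega>(1) z] unfolding d_def by blast
  \<comment> \<open>An upper bound for delta^(-a) on the disc, so that 1 \<le> c * delta^a
    there.\<close>
  define c where "c = 2 powr \<bar>-a\<bar> * d powr (-a)"
  have c: "0 < c" using d by (simp add: c_def)
  show ?thesis
  proof (rule that[of "C0 * (d / 2) powr (-2) * c"])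
    show "0 < C0 * (d / 2) powr (-2) * c" using C0 c d by simp
    fix g assume g: "g holomorphic_on \<Omega>"
    have "ennreal (cmod (g z) powr p) \<le> ennreal (C0 * (d / 2) powr (-2)) * (\<integral>\<^sup>+w. ennreal (cmod (g w) powr p * indicator (ball z (d / 2)) w) \<partial>lborel)"
      using d g sub by (intro est) (auto intro: holomorphic_on_subset)
    also have "\<dots> \<le> ennreal (C0 * (d / 2) powr (-2)) * (\<integral>\<^sup>+w. ennreal c * ennreal (cmod (g w) powr p * bdist \<Omega> w powr a * indicator \<Omega> w) \<partial>lborel)"
    proof (intro mult_left_mono nn_integral_mono)
      fix w
      show "ennreal (cmod (g w) powr p * indicator (ball z (d / 2)) w) \<le> ennreal c * ennreal (cmod (g w) powr p * bdist \<Omega> w powr a * indicator \<Omega> w)"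
      proof (cases "w \<in> ball z (d / 2)")
        case w: True
        then have wo: "w \<in> \<Omega>" using sub by auto
        then have dw0: "0 < bdist \<Omega> w" by (intro bdist_pos \<Omega>)
        have dw: "d \<le> 2 * bdist \<Omega> w" "bdist \<Omega> w \<le> 2 * d"
          using bdist_comparable[of z w \<Omega>] w unfolding d_def by auto
        have "bdist \<Omega> w powr (-a) \<le> c"
          unfolding c_def using d dw dw0 by (intro powr_le_of_comparable) auto
        then have "bdist \<Omega> w powr (-a) * bdist \<Omega> w powr a \<le> c * bdist \<Omega> w powr a"
          by (intro mult_right_mono) auto
        then have "1 \<le> c * bdist \<Omega> w powr a"
          using dw0 by (simp add: powr_add[symmetric])
        then have "cmod (g w) powr p * 1 \<le> cmod (g w) powr p * (c * bdist \<Omega> w powr a)"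
          by (intro mult_left_mono) auto
        then show ?thesis using w wo c by (simp add: ennreal_mult'[symmetric] ennreal_leI algebra_simps)
      qed simp
    qed simp
    also have "\<dots> = ennreal (C0 * (d / 2) powr (-2) * c) * weighted_integral \<Omega> p a g"
      unfolding weighted_integral_def using borel_measurable_weighted[OF \<Omega>(1) g] C0 c
      by (subst nn_integral_cmult) (auto simp: mult.assoc[symmetric] ennreal_mult'[symmetric])
    finally show "ennreal (cmod (g z) powr p) \<le> ennreal (C0 * (d / 2) powr (-2) * c) * weighted_integral \<Omega> p a g" .
  qed
qed

section \<open>Cones and Assouad exponents\<close>

text \<open>The integrand is dominated by the sum of all \<open>a j\<close> times the indicator of
  \<open>A j\<close>, so the sets may overlap. This is the common form of the two dyadic summations,
  over a cone and near the boundary.\<close>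

lemma nn_integral_le_geometric_cover:
  assumes A: "\<And>j::nat. A j \<in> sets M" and q: "0 \<le> q" "q < 1" and K: "0 \<le> K"
    and f: "\<And>x. x \<in> space M \<Longrightarrow> f x = 0 \<or> (\<exists>j. x \<in> A j \<and> f x \<le> ennreal (a j))"
    and m: "\<And>j. ennreal (a j) * emeasure M (A j) \<le> ennreal (K * q ^ j)"
  shows "(\<integral>\<^sup>+x. f x \<partial>M) \<le> ennreal (K / (1 - q))"
proof -
  have "(\<integral>\<^sup>+x. f x \<partial>M) \<le> (\<integral>\<^sup>+x. (\<Sum>j. ennreal (a j) * indicator (A j) x) \<partial>M)"
  proof (rule nn_integral_mono)
    fix x assume "x \<in> space M"
    from f[OF this] consider "f x = 0" | j where "x \<in> A j" "f x \<le> ennreal (a j)" by blast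
    then show "f x \<le> (\<Sum>j. ennreal (a j) * indicator (A j) x)"
    proof cases
      case (2 j)
      then have "f x \<le> (\<Sum>i\<in>{j}. ennreal (a i) * indicator (A i) x)" by simp
      also have "\<dots> \<le> (\<Sum>j. ennreal (a j) * indicator (A j) x)" by (rule sum_le_suminf) auto
      finally show ?thesis .
    qed simp
  qed
  also have "\<dots> = (\<Sum>j. ennreal (a j) * emeasure M (A j))"
    using A by (subst nn_integral_suminf) (auto simp: nn_integral_cmult_indicator)
  also have "\<dots> \<le> (\<Sum>j. ennreal (K * q ^ j))"
    by (intro suminf_le m) auto
  also have "\<dots> = ennreal (K * (1 / (1 - q)))"
    using q K by (intro suminf_ennreal_eq sums_mult geometric_sums) auto
  finally show ?thesis by simp
qed

lemma dyadic_above: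
  fixes d m :: real
  assumes "0 < d" "d \<le> m"
  obtains j :: nat where "m < 2 ^ j * d" "2 ^ j * d \<le> 2 * m"
proof -
  obtain n where "m / d < 2 ^ n" using real_arch_pow[of 2 "m / d"] by auto
  then have n: "m < 2 ^ n * d" using assms by (simp add: field_simps)
  define j where "j = (LEAST j::nat. m < 2 ^ j * d)"
  have j: "m < 2 ^ j * d" unfolding j_def by (rule LeastI[of _ n]) (rule n)
  then have "j \<noteq> 0" using assms by (cases j) auto
  then obtain i where i: "j = Suc i" by (cases j) auto
  then have "\<not> m < 2 ^ i * d" using not_less_Least[of i "\<lambda>j. m < 2 ^ j * d"] by (auto simp: j_def)
  then show ?thesis using that[of j] j i by simp
qed

lemma dyadic_below:
  fixes m R :: real
  assumes "0 < m" "m \<le> R"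
  obtains j :: nat where "m \<le> 2 * R / 2 ^ j" "2 * R / 2 ^ j \<le> 2 * m"
proof -
  have "1 \<le> R / m" using assms by simp
  then obtain j :: nat where "R / m < 2 ^ j * 1" "2 ^ j * 1 \<le> 2 * (R / m)" using dyadic_above[of 1 "R / m"] by auto
  then show ?thesis using assms by (intro that[of j]) (auto simp: field_simps)
qed

text \<open>In the cone delta(y) is at least max(|x-y|, delta(x)) / (1+K). A disc of radius 2^j
  delta(x) therefore contributes a weight of order (2^j delta(x))^(-\<sigma>-2) times an area of
  order (2^j delta(x))^2, and the products decay with ratio 2^(-\<sigma>).\<close>

lemma cone_weight_integral:
  assumes \<Omega>: "open \<Omega>" "bounded \<Omega>" and x: "x \<in> \<Omega>" and K: "0 \<le> K" and \<sigma>: "0 < \<sigma>"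
  shows "(\<integral>\<^sup>+y. ennreal (bdist \<Omega> y powr (-\<sigma>-2) * indicator \<Omega> y * indicator {y. dist x y \<le> K * bdist \<Omega> y} y) \<partial>lborel)
    \<le> ennreal (pi * (2 + 2 * K) powr (\<sigma> + 2) / (1 - 2 powr (-\<sigma>)) * bdist \<Omega> x powr (-\<sigma>))"
proof -
  define d where "d = bdist \<Omega> x"
  have d: "0 < d" unfolding d_def by (rule bdist_pos[OF \<Omega> x])
  \<comment> \<open>The factor 1 + K comes from the cone and the factor 2 from rounding up to a
    dyadic radius.\<close>
  define L where "L = 2 + 2 * K"
  have L: "0 < L" using K by (simp add: L_def)
  have "2 powr (-\<sigma>) < (2::real) powr 0" using \<sigma> by (intro powr_less_mono) auto
  then have q: "2 powr (-\<sigma>) < (1::real)" by simp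
  have "(\<integral>\<^sup>+y. ennreal (bdist \<Omega> y powr (-\<sigma>-2) * indicator \<Omega> y * indicator {y. dist x y \<le> K * bdist \<Omega> y} y) \<partial>lborel)
    \<le> ennreal (pi * L powr (\<sigma> + 2) * d powr (-\<sigma>) / (1 - 2 powr (-\<sigma>)))"
  proof (rule nn_integral_le_geometric_cover[where A="\<lambda>j. ball x (2 ^ j * d)" and a="\<lambda>j. (2 ^ j * d / L) powr (-\<sigma>-2)"])
    fix j :: nat
    have "(2 ^ j * d / L) powr (-\<sigma>-2) * (pi * (2 ^ j * d)\<^sup>2) = pi * L powr (\<sigma> + 2) * (2 ^ j * d) powr (-\<sigma>)"
      using d L by (simp add: powr_divide powr_diff powr_minus powr_add powr_numeral field_simps)
    also have "(2 ^ j * d) powr (-\<sigma>) = d powr (-\<sigma>) * (2 powr (-\<sigma>)) ^ j"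
      using d by (simp add: powr_mult powr_realpow[symmetric] powr_powr mult.commute)
    finally show "ennreal ((2 ^ j * d / L) powr (-\<sigma>-2)) * emeasure lborel (ball x (2 ^ j * d))
        \<le> ennreal (pi * L powr (\<sigma> + 2) * d powr (-\<sigma>) * (2 powr (-\<sigma>)) ^ j)"
      using d by (simp add: emeasure_ball_complex ennreal_mult'[symmetric] mult.assoc)
  next
    fix y
    show "ennreal (bdist \<Omega> y powr (-\<sigma>-2) * indicator \<Omega> y * indicator {y. dist x y \<le> K * bdist \<Omega> y} y) = 0 \<or>
      (\<exists>j. y \<in> ball x (2 ^ j * d) \<and> ennreal (bdist \<Omega> y powr (-\<sigma>-2) * indicator \<Omega> y * indicator {y. dist x y \<le> K * bdist \<Omega> y} y)
          \<le> ennreal ((2 ^ j * d / L) powr (-\<sigma>-2)))"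
    proof (cases "y \<in> \<Omega> \<and> dist x y \<le> K * bdist \<Omega> y")
      case True
      obtain j :: nat where j: "max (dist x y) d < 2 ^ j * d" "2 ^ j * d \<le> 2 * max (dist x y) d"
        using dyadic_above[of d "max (dist x y) d"] d by auto
      have "d \<le> (1 + K) * bdist \<Omega> y"
        using abs_le_D1[OF bdist_Lipschitz[of \<Omega> x y]] True unfolding d_def distrib_right by simp
      moreover have "dist x y \<le> (1 + K) * bdist \<Omega> y"
        using True bdist_nonneg[of \<Omega> y] unfolding distrib_right by linarith
      ultimately have "2 ^ j * d \<le> 2 * ((1 + K) * bdist \<Omega> y)" using j by linarith
      then have "2 ^ j * d / L \<le> bdist \<Omega> y" using L by (simp add: L_def field_simps)
      then have "bdist \<Omega> y powr (-\<sigma>-2) \<le> (2 ^ j * d / L) powr (-\<sigma>-2)"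
        using d L \<sigma> by (intro powr_mono2') auto
      then show ?thesis using True j by (intro disjI2 exI[of _ j]) (auto intro: ennreal_leI)
    qed (auto simp: indicator_def)
  qed (use q d L in auto)
  then show ?thesis by (simp add: d_def L_def mult_ac)
qed

section \<open>Assouad exponents and powers of the distance\<close>

text \<open>A nonempty set of extended naturals attains its infimum, and a finite bound excludes the
  empty family of covers, whose infimum is infinite.\<close>

lemma covering_number_le_obtain:
  assumes "ereal_of_enat (covering_number r A) \<le> ereal c"
  obtains X where "finite X" "A \<subseteq> (\<Union>x\<in>X. ball x r)" "real (card X) \<le> c"
proof -
  let ?S = "{X. finite X \<and> A \<subseteq> (\<Union>x\<in>X. ball x r)}"
  have ne: "?S \<noteq> {}"
  proof
    assume e: "?S = {}"
    have "covering_number r A = \<infinity>" unfolding covering_number_def e by (simp add: top_enat_def)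
    with assms show False by simp
  qed
  then obtain Y where "Y \<in> ?S" by blast
  then have "covering_number r A \<in> (\<lambda>X. enat (card X)) ` ?S"
    unfolding covering_number_def by (intro wellorder_InfI[of "enat (card Y)"]) blast
  then obtain X where "X \<in> ?S" "covering_number r A = enat (card X)" by blast
  with assms show ?thesis by (intro that[of X]) auto
qed

text \<open>An admissible exponent of \<open>assouad_dim\<close>, with the covering number replaced
  by an explicit cover. The dimension itself is an infimum and may fail to be admissible, so the
  proof works with such an exponent \<open>s\<close>.\<close>

definition assouad_bound :: "complex set \<Rightarrow> real \<Rightarrow> bool" where
  "assouad_bound E s \<longleftrightarrow> 0 \<le> s \<and> (\<exists>C>0. \<forall>x\<in>E. \<forall>r R. 0 < r \<and> r < R \<longrightarrow>
        (\<exists>X. finite X \<and> E \<inter> ball x R \<subseteq> (\<Union>x\<in>X. ball x r) \<and> real (card X) \<le> C * (R / r) powr s))"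

lemma assouad_dim_less_obtain:
  assumes "assouad_dim E < ereal t"
  obtains s where "s < t" "assouad_bound E s"
proof -
  obtain s C where s: "s < t" "0 \<le> s" "0 < C"
    "\<forall>x\<in>E. \<forall>r R. 0 < r \<and> r < R \<longrightarrow> ereal_of_enat (covering_number r (E \<inter> ball x R)) \<le> ereal (C * (R / r) powr s)"
    using assms unfolding assouad_dim_def Inf_less_iff by auto
  have "assouad_bound E s"
    unfolding assouad_bound_def
  proof (intro conjI exI[of _ C] ballI allI impI)
    fix x and r R :: real assume "x \<in> E" "0 < r \<and> r < R"
    with s(4) have "ereal_of_enat (covering_number r (E \<inter> ball x R)) \<le> ereal (C * (R / r) powr s)" by blast
    then show "\<exists>X. finite X \<and> E \<inter> ball x R \<subseteq> (\<Union>x\<in>X. ball x r) \<and> real (card X) \<le> C * (R / r) powr s"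
      by (rule covering_number_le_obtain) blast
  qed (use s in auto)
  with s show ?thesis using that by blast
qed

text \<open>A square grid of mesh r/2 suffices: rounding each coordinate moves a point by at most r
  / sqrt 2 < r. The constant is 7^2, since a row has 2n + 1 \<le> 4R/r + 3 \<le> 7R/r
  points.\<close>

lemma assouad_bound_2: "assouad_bound E 2"
  unfolding assouad_bound_def
proof (intro conjI exI[of _ 49] ballI allI impI)
  fix x r R :: real and z assume "0 < r \<and> r < R"
  then have r: "0 < r" "r < R" by auto
  define n where "n = nat \<lceil>2 * R / r\<rceil>"
  have n1: "2 * R / r \<le> real n" using r by (simp add: n_def) 
  have n2: "real n \<le> 2 * R / r + 1" proof -
    have "0 \<le> 2 * R / r" using r by simp
    then have "real n = real_of_int \<lceil>2 * R / r\<rceil>" unfolding n_def by (intro of_nat_nat) simp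
    then show ?thesis by linarith
  qed
  define P where "P = (\<lambda>(i, j). z + Complex (r / 2 * real_of_int i) (r / 2 * real_of_int j)) ` ({-int n..int n} \<times> {-int n..int n})"
  have "card P \<le> card ({-int n..int n} \<times> {-int n..int n})" unfolding P_def by (rule card_image_le) auto
  also have "\<dots> = (2 * n + 1)\<^sup>2" 
  proof -
    have "card {-int n..int n} = 2 * n + 1" by simp
    then show ?thesis by (simp only: card_cartesian_product power2_eq_square)
  qed
  finally have "real (card P) \<le> real ((2 * n + 1)\<^sup>2)" by (rule of_nat_mono)
  also have "\<dots> = (2 * real n + 1)\<^sup>2" by simp
  also have "\<dots> \<le> (7 * (R / r))\<^sup>2"
  proof (rule power_mono)
    have "1 \<le> R / r" using r by simp
    then show "2 * real n + 1 \<le> 7 * (R / r)" using n2 by simp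
  qed simp
  also have "\<dots> = 49 * (R / r) powr 2" using r by (simp add: powr_numeral power2_eq_square)
  finally have c: "real (card P) \<le> 49 * (R / r) powr 2" .
  have near: "\<exists>i\<in>{-int n..int n}. \<bar>t - r / 2 * real_of_int i\<bar> \<le> r / 2" if "\<bar>t\<bar> < R" for t
  proof (intro bexI)
    let ?i = "\<lfloor>2 * t / r\<rfloor>"
    have fl: "real_of_int ?i \<le> 2 * t / r" "2 * t / r < real_of_int ?i + 1" by linarith+
    have "real_of_int ?i * r \<le> 2 * t" "2 * t < (real_of_int ?i + 1) * r"
      using fl(1)[unfolded pos_le_divide_eq[OF r(1)]] fl(2)[unfolded pos_divide_less_eq[OF r(1)]] by blast+
    then show "\<bar>t - r / 2 * real_of_int ?i\<bar> \<le> r / 2" using r by (simp add: abs_le_iff field_simps)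
    have "\<bar>2 * t / r\<bar> < 2 * R / r" using that r by (simp add: abs_mult abs_divide divide_strict_right_mono)
    then have "\<bar>2 * t / r\<bar> < real n" using n1 by linarith
    then have "- real n \<le> 2 * t / r" "2 * t / r \<le> real n" by linarith+
    then show "?i \<in> {-int n..int n}" by (auto simp: le_floor_iff floor_le_iff)
  qed
  have "E \<inter> ball z R \<subseteq> (\<Union>x\<in>P. ball x r)"
  proof
    fix w assume "w \<in> E \<inter> ball z R"
    then have w: "cmod (w - z) < R" by (simp add: dist_norm norm_minus_commute)
    obtain i where i: "i \<in> {-int n..int n}" "\<bar>Re (w - z) - r / 2 * real_of_int i\<bar> \<le> r / 2"
      using near[of "Re (w - z)"] abs_Re_le_cmod[of "w - z"] w by auto
    obtain j where j: "j \<in> {-int n..int n}" "\<bar>Im (w - z) - r / 2 * real_of_int j\<bar> \<le> r / 2"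
      using near[of "Im (w - z)"] abs_Im_le_cmod[of "w - z"] w by auto
    let ?c = "z + Complex (r / 2 * real_of_int i) (r / 2 * real_of_int j)"
    have "(cmod (w - ?c))\<^sup>2 \<le> (r / 2)\<^sup>2 + (r / 2)\<^sup>2"
      unfolding cmod_power2 using i(2) j(2) r by (intro add_mono abs_le_square_iff[THEN iffD1]) (auto simp: diff_diff_eq)
    also have "\<dots> < r\<^sup>2" using r by (simp add: power2_eq_square)
    finally have "cmod (w - ?c) < r" by (rule power2_less_imp_less) (use r in simp)
    moreover have "?c \<in> P" unfolding P_def using i j by force
    ultimately show "w \<in> (\<Union>x\<in>P. ball x r)" by (auto simp: dist_norm norm_minus_commute)
  qed
  then show "\<exists>X. finite X \<and> E \<inter> ball z R \<subseteq> (\<Union>x\<in>X. ball x r) \<and> real (card X) \<le> 49 * (R / r) powr 2"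
    using c by (intro exI[of _ P]) (auto simp: P_def)
qed auto

text \<open>At scale r_j = 2R / 2^j the points within r_j of \<open>E\<close> are covered by about
  (R / r_j)^s discs of radius 2 r_j. Their area times r_j^\<beta> is of order R^s r_j^(\<beta>+2-s),
  a geometric sequence with ratio 2^(s-\<beta>-2) < 1.\<close>

lemma assouad_weight_integral:
  assumes E: "assouad_bound E s" "closed E" and \<beta>: "s < \<beta> + 2"
  obtains C where "0 < C" "\<And>w R. w \<in> E \<Longrightarrow> 0 < R \<Longrightarrow>
    (\<integral>\<^sup>+x. ennreal (infdist x E powr \<beta> * indicator (ball w R) x) \<partial>lborel) \<le> ennreal (C * R powr (\<beta> + 2))"
proof -
  obtain CA where CA: "0 < CA" and s: "0 \<le> s" and cov: "\<And>x r R. x \<in> E \<Longrightarrow> 0 < r \<Longrightarrow> r < R \<Longrightarrow>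
        \<exists>X. finite X \<and> E \<inter> ball x R \<subseteq> (\<Union>x\<in>X. ball x r) \<and> real (card X) \<le> CA * (R / r) powr s"
    using E(1) unfolding assouad_bound_def by blast
  define C where "C = 2 powr \<bar>\<beta>\<bar> * 4 * pi * CA * 2 powr s * 2 powr (\<beta> + 2)"
  have C: "0 < C" using CA by (simp add: C_def)
  define q where "q = (2::real) powr (s - (\<beta> + 2))"
  have "(2::real) powr (s - (\<beta> + 2)) < 2 powr 0" using \<beta> by (intro powr_less_mono) auto
  then have q: "0 \<le> q" "q < 1" by (auto simp: q_def)
  show ?thesis
  proof (rule that[of "C / (1 - q)"])
    show "0 < C / (1 - q)" using C q by simp
    fix w and R :: real assume w: "w \<in> E" and R: "0 < R"
    define r where "r j = 2 * R / 2 ^ j" for j :: nat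
    have r: "0 < r j" "r j \<le> 2 * R" for j
    proof -
      have "(1::real) \<le> 2 ^ j" by simp
      then show "0 < r j" "r j \<le> 2 * R" using R by (auto simp: r_def divide_le_eq)
    qed
    define A where "A j = {x \<in> ball w R. infdist x E \<le> r j}" for j
    have [measurable]: "(\<lambda>x. infdist x E) \<in> borel_measurable borel"
      by (intro borel_measurable_continuous_onI continuous_intros)
    have "ball w R \<inter> {x. infdist x E \<le> r j} \<in> sets borel" for j
      by (intro sets.Int) (auto simp: pred_def)
    then have mA: "A j \<in> sets lborel" for j by (simp add: A_def Collect_conj_eq)
    have "(\<integral>\<^sup>+x. ennreal (infdist x E powr \<beta> * indicator (ball w R) x) \<partial>lborel) \<le> ennreal (C * R powr (\<beta> + 2) / (1 - q))"
    proof (rule nn_integral_le_geometric_cover[where A=A and a="\<lambda>j. 2 powr \<bar>\<beta>\<bar> * r j powr \<beta>"])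
      fix j
      \<comment> \<open>A nearest point of \<open>E\<close> lies within R + r_j \<le> 3R of
        \<open>w\<close>, so the cover is taken in the ball of radius 4R; this also ensures r_j <
        4R.\<close>
      obtain X where X: "finite X" "E \<inter> ball w (4 * R) \<subseteq> (\<Union>x\<in>X. ball x (r j))" "real (card X) \<le> CA * (4 * R / r j) powr s"
        using cov[of w "r j" "4 * R"] w r[of j] R by auto
      have sub: "A j \<subseteq> (\<Union>x\<in>X. ball x (2 * r j))"
      proof
        fix x assume "x \<in> A j"
        then have x: "dist w x < R" "infdist x E \<le> r j" by (auto simp: A_def)
        obtain v where v: "v \<in> E" "infdist x E = dist x v"
          using infdist_attains_inf[of E x] E w by auto
        have "dist w v < 4 * R" using dist_triangle[of w v x] x v r(2)[of j] R by simp
        then obtain y where y: "y \<in> X" "dist y v < r j" using X(2) v by (auto simp: subset_iff)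
        have "dist y x < 2 * r j" using dist_triangle[of y x v] x v y by (simp add: dist_commute)
        then show "x \<in> (\<Union>x\<in>X. ball x (2 * r j))" using y by auto
      qed
      have "emeasure lborel (A j) \<le> emeasure lborel (\<Union>x\<in>X. ball x (2 * r j))"
        by (rule emeasure_mono[OF sub]) (simp add: borel_open open_UN)
      also have "\<dots> \<le> (\<Sum>x\<in>X. emeasure lborel (ball x (2 * r j)))"
        by (rule emeasure_subadditive_finite) (use X in auto)
      also have "\<dots> = ennreal (real (card X) * (4 * pi * (r j)\<^sup>2))"
        using r(1)[of j] by (simp add: emeasure_ball_complex power_mult_distrib ennreal_mult' ennreal_of_nat_eq_real_of_nat mult_ac)
      also have "\<dots> \<le> ennreal (CA * (4 * R / r j) powr s * (4 * pi * (r j)\<^sup>2))"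
        using X(3) by (intro ennreal_leI mult_right_mono) auto
      finally have em: "emeasure lborel (A j) \<le> \<dots>" .
      have "ennreal (2 powr \<bar>\<beta>\<bar> * r j powr \<beta>) * emeasure lborel (A j)
          \<le> ennreal (2 powr \<bar>\<beta>\<bar> * r j powr \<beta>) * ennreal (CA * (4 * R / r j) powr s * (4 * pi * (r j)\<^sup>2))"
        by (rule mult_left_mono[OF em]) simp
      also have "\<dots> = ennreal (C * R powr (\<beta> + 2) * q ^ j)"
      proof -
        have "4 * R / r j = 2 * 2 ^ j" using R by (simp add: r_def field_simps)
        then have 1: "(4 * R / r j) powr s = 2 powr s * 2 powr (real j * s)"
          by (simp add: powr_mult powr_realpow[symmetric] powr_powr)
        have "r j powr \<beta> * (r j)\<^sup>2 = r j powr (\<beta> + 2)"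
          using r(1)[of j] by (simp add: powr_add powr_numeral)
        also have "\<dots> = (2 * R * 2 powr (- real j)) powr (\<beta> + 2)"
          by (simp add: r_def powr_minus powr_realpow field_simps)
        also have "\<dots> = 2 powr (\<beta> + 2) * R powr (\<beta> + 2) * 2 powr (- real j * (\<beta> + 2))"
          using R by (simp add: powr_mult powr_powr)
        finally have 2: "r j powr \<beta> * (r j)\<^sup>2 = \<dots>" .
        have 3: "2 powr (real j * s) * 2 powr (- real j * (\<beta> + 2)) = q ^ j"
          by (simp add: q_def powr_add[symmetric] powr_realpow[symmetric] powr_powr algebra_simps)
        have "2 powr \<bar>\<beta>\<bar> * r j powr \<beta> * (CA * (4 * R / r j) powr s * (4 * pi * (r j)\<^sup>2))
          = 2 powr \<bar>\<beta>\<bar> * CA * 4 * pi * (4 * R / r j) powr s * (r j powr \<beta> * (r j)\<^sup>2)" by (simp only: mult_ac)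
        also have "\<dots> = C * R powr (\<beta> + 2) * (2 powr (real j * s) * 2 powr (- real j * (\<beta> + 2)))"
          unfolding 1 2 C_def by (simp only: mult_ac)
        finally show ?thesis unfolding 3 using CA by (subst ennreal_mult[symmetric]) auto
      qed
      finally show "ennreal (2 powr \<bar>\<beta>\<bar> * r j powr \<beta>) * emeasure lborel (A j) \<le> ennreal (C * R powr (\<beta> + 2) * q ^ j)" .
    next
      fix x
      show "ennreal (infdist x E powr \<beta> * indicator (ball w R) x) = 0 \<or>
        (\<exists>j. x \<in> A j \<and> ennreal (infdist x E powr \<beta> * indicator (ball w R) x) \<le> ennreal (2 powr \<bar>\<beta>\<bar> * r j powr \<beta>))"
      proof (cases "x \<in> ball w R \<and> infdist x E > 0")
        case True
        then have "infdist x E \<le> R" using infdist_le[OF w, of x] by (simp add: dist_commute)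
        then obtain j where j: "infdist x E \<le> r j" "r j \<le> 2 * infdist x E"
          using dyadic_below[of "infdist x E" R] True unfolding r_def by auto
        have "infdist x E powr \<beta> \<le> 2 powr \<bar>\<beta>\<bar> * r j powr \<beta>"
          using True j r(1)[of j] by (intro powr_le_of_comparable) auto
        then show ?thesis using True j by (intro disjI2 exI[of _ j]) (auto simp: A_def intro: ennreal_leI)
      next
        case False
        \<comment> \<open>On \<open>E\<close> itself the integrand vanishes even for negative
          \<beta>, because \<open>0 powr \<beta> = 0\<close>.\<close>
        then have "infdist x E powr \<beta> * indicator (ball w R) x = 0"
          using infdist_nonneg[of x E] by (cases "x \<in> ball w R") auto
        then show ?thesis by simp
      qed
    qed (use mA q C in auto)
    then show "(\<integral>\<^sup>+x. ennreal (infdist x E powr \<beta> * indicator (ball w R) x) \<partial>lborel) \<le> ennreal (C / (1 - q) * R powr (\<beta> + 2))"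
      by simp
  qed
qed

section \<open>John curves\<close>

text \<open>Appending \<open>t\<close> to a partition of [0, s] shows that the length up to s plus
  the chord from s to t is at most the length up to t; these lengths are s and t.\<close>

lemma arclength_parametrized_Lipschitz:
  assumes \<gamma>: "arclength_parametrized \<gamma> l" and st: "0 \<le> s" "s \<le> t" "t \<le> l"
  shows "dist (\<gamma> s) (\<gamma> t) \<le> t - s"
proof -
  let ?P = "\<lambda>u. {(n :: nat, \<tau> :: nat \<Rightarrow> real). \<tau> 0 = 0 \<and> \<tau> n = u \<and> (\<forall>i<n. \<tau> i \<le> \<tau> (Suc i))}"
  let ?f = "\<lambda>(n :: nat, \<tau>). \<Sum>i<n. ennreal (dist (\<gamma> (\<tau> i)) (\<gamma> (\<tau> (Suc i))))"
  have ne: "?P s \<noteq> {}"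
  proof -
    have "(1, \<lambda>i. if i = 0 then 0 else s) \<in> ?P s" using st by simp
    then show ?thesis by blast
  qed
  have "curve_length \<gamma> 0 s + ennreal (dist (\<gamma> s) (\<gamma> t)) = (SUP x\<in>?P s. ?f x + ennreal (dist (\<gamma> s) (\<gamma> t)))"
    unfolding curve_length_def by (rule ennreal_SUP_add_left[OF ne, symmetric])
  also have "\<dots> \<le> curve_length \<gamma> 0 t"
  proof (rule SUP_least)
    fix x assume "x \<in> ?P s"
    then obtain n \<tau> where x: "x = (n, \<tau>)" "\<tau> 0 = 0" "\<tau> n = s" "\<And>i. i < n \<Longrightarrow> \<tau> i \<le> \<tau> (Suc i)" by auto
    let ?\<tau> = "\<tau>(Suc n := t)"
    have "(Suc n, ?\<tau>) \<in> ?P t" using x st by (auto simp: less_Suc_eq)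
    then have "?f (Suc n, ?\<tau>) \<le> curve_length \<gamma> 0 t"
      unfolding curve_length_def by (rule SUP_upper)
    moreover have "?f (Suc n, ?\<tau>) = ?f x + ennreal (dist (\<gamma> s) (\<gamma> t))"
      using x by (simp add: sum_nonneg)
    ultimately show "?f x + ennreal (dist (\<gamma> s) (\<gamma> t)) \<le> curve_length \<gamma> 0 t" by simp
  qed
  finally have "ennreal s + ennreal (dist (\<gamma> s) (\<gamma> t)) \<le> ennreal t"
    using \<gamma> st by (simp add: arclength_parametrized_def)
  then have "s + dist (\<gamma> s) (\<gamma> t) \<le> t"
    using st by (simp add: ennreal_plus[symmetric] del: ennreal_plus)
  then show ?thesis by simp
qed

text \<open>The constant is large enough for the mean value inequality at every point near \<open>v\<close>,
  see \<open>disc_average_bound\<close>; this avoids comparing \<open>g\<close> along the curve with its modulus of continuity.\<close>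

definition disc_average :: "complex set \<Rightarrow> (complex \<Rightarrow> complex) \<Rightarrow> complex \<Rightarrow> ennreal" where
  "disc_average \<Omega> g v = ennreal (1024 / (bdist \<Omega> v)\<^sup>2) *
     (\<integral>\<^sup>+y. (if dist v y < bdist \<Omega> v / 2 then ennreal (cmod (g y) * indicator \<Omega> y) else 0) \<partial>lborel)"

lemma borel_measurable_disc_average:
  assumes "open \<Omega>" "g holomorphic_on \<Omega>"
  shows "disc_average \<Omega> g \<in> borel_measurable borel"
proof -
  have [measurable]: "(\<lambda>y. cmod (g y) * indicator \<Omega> y) \<in> borel_measurable borel"
    using assms by (intro borel_measurable_indicator_norm holomorphic_on_imp_continuous_on) auto
  show ?thesis unfolding disc_average_def by measurable
qed

text \<open>With D = delta(x), both m and v lie within D/10 of x, and delta(v) is between 9D/10 and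
  11D/10. Since D/4 + D/5 = (9D/10) / 2, the disc of radius D/4 around m lies in the averaging disc
  of v. Its mean value constant is 32 / (D/4)^2 = 512 / D^2 \<le> 1024 / delta(v)^2.\<close>

lemma disc_average_bound:
  assumes \<Omega>: "open \<Omega>" "bounded \<Omega>" and g: "g holomorphic_on \<Omega>" and x: "x \<in> \<Omega>"
    and d: "10 * d \<le> bdist \<Omega> x" "0 < d" and m: "dist x m \<le> d" and v: "dist x v \<le> d"
  shows "ennreal (cmod (g m)) \<le> disc_average \<Omega> g v"
proof -
  define D where "D = bdist \<Omega> x"
  have D: "0 < D" "10 * d \<le> D" using d by (auto simp: D_def)
  have \<delta>: "bdist \<Omega> v \<ge> 9 / 10 * D" "bdist \<Omega> v \<le> 11 / 10 * D"
    using bdist_Lipschitz[of \<Omega> x v] v D unfolding D_def by linarith+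
  have "ball m (D / 4) \<subseteq> ball x D"
    using m D by (simp add: ball_subset_ball_iff dist_commute)
  then have sub: "ball m (D / 4) \<subseteq> \<Omega>" using ball_bdist_subset[OF \<Omega>(1) x] unfolding D_def by blast
  have near: "dist v y < bdist \<Omega> v / 2" if "y \<in> ball m (D / 4)" for y
    using dist_triangle[of v y m] dist_triangle[of v m x] that m v D \<delta> by (simp add: dist_commute)
  have "ennreal (cmod (g m)) \<le> ennreal (32 / (D / 4)\<^sup>2) * (\<integral>\<^sup>+w. ennreal (cmod (g w) * indicator (ball m (D / 4)) w) \<partial>lborel)"
    using D by (intro area_mean_value holomorphic_on_subset[OF g sub]) auto
  also have "\<dots> \<le> disc_average \<Omega> g v"
    unfolding disc_average_def
  proof (rule mult_mono)
    have "(bdist \<Omega> v)\<^sup>2 \<le> (11 / 10 * D)\<^sup>2" using \<delta>(2) by (intro power_mono) auto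
    also have "\<dots> \<le> 2 * D\<^sup>2" by (simp add: power2_eq_square)
    finally have "1024 / (2 * D\<^sup>2) \<le> 1024 / (bdist \<Omega> v)\<^sup>2"
      using \<delta> D by (intro divide_left_mono mult_pos_pos) auto
    then show "ennreal (32 / (D / 4)\<^sup>2) \<le> ennreal (1024 / (bdist \<Omega> v)\<^sup>2)"
      by (intro ennreal_leI) (simp add: power_divide)
    show "(\<integral>\<^sup>+w. ennreal (cmod (g w) * indicator (ball m (D / 4)) w) \<partial>lborel)
      \<le> (\<integral>\<^sup>+y. (if dist v y < bdist \<Omega> v / 2 then ennreal (cmod (g y) * indicator \<Omega> y) else 0) \<partial>lborel)"
      using near sub by (intro nn_integral_mono) (auto simp: indicator_def)
  qed auto
  finally show ?thesis .
qed

text \<open>The estimate is additive over adjacent intervals, so by \<open>Bolzano\<close> it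
  suffices to prove it on short ones. There the increment is at most the maximum of |g'| over a
  small disc times the length of the interval, and the average at every curve point in that disc
  dominates this maximum.\<close>

lemma curve_increment_le:
  fixes \<eta> :: "real \<Rightarrow> complex"
  assumes \<Omega>: "open \<Omega>" "bounded \<Omega>" and g: "g holomorphic_on \<Omega>"
    and \<eta>: "\<And>s t. dist (\<eta> s) (\<eta> t) \<le> \<bar>s - t\<bar>" "\<And>t. \<eta> t \<in> \<Omega>" and ab: "a \<le> b"
  shows "ennreal (cmod (g (\<eta> b) - g (\<eta> a))) \<le> (\<integral>\<^sup>+t. disc_average \<Omega> (deriv g) (\<eta> t) * indicator {a<..b} t \<partial>lborel)"
proof -
  have g': "deriv g holomorphic_on \<Omega>" using g \<Omega>(1) by (rule holomorphic_deriv)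
  have "continuous_on UNIV \<eta>"
    by (rule lipschitz_on_continuous_on[of 1], rule lipschitz_onI) (use \<eta>(1) in \<open>simp_all add: dist_real_def\<close>)
  then have "\<eta> \<in> borel_measurable borel" by (rule borel_measurable_continuous_onI)
  then have [measurable]: "(\<lambda>t. disc_average \<Omega> (deriv g) (\<eta> t)) \<in> borel_measurable borel"
    by (rule measurable_compose[OF _ borel_measurable_disc_average[OF \<Omega>(1) g']])
  \<comment> \<open>Half-open intervals make the integrals over adjacent pieces add up
    exactly.\<close>
  define P where "P s t \<longleftrightarrow> (s \<le> t \<longrightarrow>
    ennreal (cmod (g (\<eta> t) - g (\<eta> s))) \<le> (\<integral>\<^sup>+\<tau>. disc_average \<Omega> (deriv g) (\<eta> \<tau>) * indicator {s<..t} \<tau> \<partial>lborel))" for s t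
  from ab have "P a b"
  proof (induction rule: Bolzano)
    case (trans a b c)
    have "ennreal (cmod (g (\<eta> c) - g (\<eta> a))) \<le> ennreal (cmod (g (\<eta> b) - g (\<eta> a)) + cmod (g (\<eta> c) - g (\<eta> b)))"
      using norm_triangle_ineq[of "g (\<eta> b) - g (\<eta> a)" "g (\<eta> c) - g (\<eta> b)"] by (intro ennreal_leI) simp
    also have "\<dots> = ennreal (cmod (g (\<eta> b) - g (\<eta> a))) + ennreal (cmod (g (\<eta> c) - g (\<eta> b)))" by simp
    also have "\<dots> \<le> (\<integral>\<^sup>+\<tau>. disc_average \<Omega> (deriv g) (\<eta> \<tau>) * indicator {a<..b} \<tau> \<partial>lborel) + (\<integral>\<^sup>+\<tau>. disc_average \<Omega> (deriv g) (\<eta> \<tau>) * indicator {b<..c} \<tau> \<partial>lborel)"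
      using trans by (intro add_mono) (auto simp: P_def)
    also have "\<dots> = (\<integral>\<^sup>+\<tau>. disc_average \<Omega> (deriv g) (\<eta> \<tau>) * indicator {a<..b} \<tau> + disc_average \<Omega> (deriv g) (\<eta> \<tau>) * indicator {b<..c} \<tau> \<partial>lborel)"
      by (rule nn_integral_add[symmetric]) measurable
    also have "\<dots> = (\<integral>\<^sup>+\<tau>. disc_average \<Omega> (deriv g) (\<eta> \<tau>) * indicator {a<..c} \<tau> \<partial>lborel)"
      using trans by (intro nn_integral_cong) (auto simp: indicator_def)
    finally show ?case by (simp add: P_def)
  next
    case (local x)
    define D where "D = bdist \<Omega> (\<eta> x)"
    have D: "0 < D" unfolding D_def by (rule bdist_pos[OF \<Omega> \<eta>(2)])
    define d where "d = D / 10"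
    have d: "0 < d" "10 * d \<le> bdist \<Omega> (\<eta> x)" using D by (auto simp: d_def D_def)
    let ?B = "cball (\<eta> x) d"
    have "?B \<subseteq> ball (\<eta> x) D" using d D by (auto simp: d_def)
    then have sub: "?B \<subseteq> \<Omega>" using ball_bdist_subset[OF \<Omega>(1) \<eta>(2)[of x]] unfolding D_def by blast
    have "continuous_on ?B (\<lambda>w. cmod (deriv g w))"
      by (intro continuous_intros holomorphic_on_imp_continuous_on holomorphic_on_subset[OF g' sub])
    then obtain m where m: "m \<in> ?B" "\<And>w. w \<in> ?B \<Longrightarrow> cmod (deriv g w) \<le> cmod (deriv g m)"
      using continuous_attains_sup[of ?B "\<lambda>w. cmod (deriv g w)"] d by fastforce
    show ?case
    proof (intro exI[of _ d] conjI allI impI d(1))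
      fix s t assume st: "s \<le> x \<and> x \<le> t \<and> t - s < d"
      have inB: "\<eta> \<tau> \<in> ?B" if "\<tau> \<in> {s..t}" for \<tau>
        using \<eta>(1)[of x \<tau>] st that by auto
      have "cmod (g (\<eta> t) - g (\<eta> s)) \<le> cmod (deriv g m) * cmod (\<eta> t - \<eta> s)"
      proof (rule field_differentiable_bound[of ?B g "deriv g"])
        fix w assume w: "w \<in> ?B"
        show "(g has_field_derivative deriv g w) (at w within ?B)"
          using holomorphic_derivI[OF g \<Omega>(1)] w sub by blast
      qed (use m inB st in auto)
      also have "\<dots> \<le> cmod (deriv g m) * (t - s)"
        using \<eta>(1)[of t s] st by (intro mult_left_mono) (auto simp: dist_norm)
      finally have "ennreal (cmod (g (\<eta> t) - g (\<eta> s))) \<le> ennreal (cmod (deriv g m)) * ennreal (t - s)"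
        using st by (simp add: ennreal_mult'[symmetric] ennreal_leI)
      also have "\<dots> = (\<integral>\<^sup>+\<tau>. ennreal (cmod (deriv g m)) * indicator {s<..t} \<tau> \<partial>lborel)"
        using st by (subst nn_integral_cmult_indicator) auto
      also have "\<dots> \<le> (\<integral>\<^sup>+\<tau>. disc_average \<Omega> (deriv g) (\<eta> \<tau>) * indicator {s<..t} \<tau> \<partial>lborel)"
      proof (rule nn_integral_mono)
        fix \<tau>
        show "ennreal (cmod (deriv g m)) * indicator {s<..t} \<tau> \<le> disc_average \<Omega> (deriv g) (\<eta> \<tau>) * indicator {s<..t} \<tau>"
          using disc_average_bound[OF \<Omega> g' \<eta>(2) d(2,1), of m "\<eta> \<tau>"] m(1) inB[of \<tau>]
          by (cases "\<tau> \<in> {s<..t}") auto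
      qed
      finally show "P s t" by (simp add: P_def)
    qed
  qed
  with ab show ?thesis by (simp add: P_def)
qed

lemma john_pointwise_bound:
  assumes "bounded_john_domain \<Omega>"
  obtains x0 A K where "x0 \<in> \<Omega>" "0 < A" "0 \<le> K"
    "\<And>g x. g holomorphic_on \<Omega> \<Longrightarrow> x \<in> \<Omega> \<Longrightarrow> ennreal (cmod (g x - g x0)) \<le>
       (\<integral>\<^sup>+y. ennreal (A * cmod (deriv g y) / bdist \<Omega> y * indicator \<Omega> y * indicator {y. dist x y \<le> K * bdist \<Omega> y} y) \<partial>lborel)"
proof -
  have \<Omega>: "open \<Omega>" "bounded \<Omega>" using assms by (auto simp: bounded_john_domain_def)
  obtain x0 c where x0: "x0 \<in> \<Omega>" and c: "0 < c" and J: "\<forall>x\<in>\<Omega>. \<exists>l\<ge>0. \<exists>\<gamma>.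
        arclength_parametrized \<gamma> l \<and> \<gamma> ` {0..l} \<subseteq> \<Omega> \<and> \<gamma> 0 = x \<and> \<gamma> l = x0 \<and>
        (\<forall>t\<in>{0..l}. bdist \<Omega> (\<gamma> t) \<ge> c * t)"
    using assms unfolding bounded_john_domain_def by (elim conjE bexE exE) (rule that)
  \<comment> \<open>4608 = 1024 * (3/2)^2 * 2: the constant of \<open>disc_average\<close>, the
    comparison delta(y) \<le> 3/2 delta(curve point), and the length 2 delta(y) / c of the times
    that see y. \<open>K\<close> adds the way along the curve, at most 2 delta(y) / c, to the radius
    of the disc, at most delta(y).\<close>
  define A where "A = 4608 / c"
  define K where "K = 2 / c + 1"
  have A: "0 < A" and K: "0 \<le> K" using c by (auto simp: A_def K_def)
  show ?thesis
  proof (rule that[OF x0 A K])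
    fix g x assume g: "g holomorphic_on \<Omega>" and x: "x \<in> \<Omega>"
    have g': "deriv g holomorphic_on \<Omega>" using g \<Omega>(1) by (rule holomorphic_deriv)
    obtain l \<gamma> where l: "0 \<le> l" and \<gamma>: "arclength_parametrized \<gamma> l" "\<gamma> ` {0..l} \<subseteq> \<Omega>" "\<gamma> 0 = x" "\<gamma> l = x0"
      "\<And>t. t \<in> {0..l} \<Longrightarrow> bdist \<Omega> (\<gamma> t) \<ge> c * t" using bspec[OF J x] by (elim conjE exE) (rule that, blast+)
    \<comment> \<open>Freezing the curve outside [0, l] gives a map of the whole line that is
      globally 1-Lipschitz and stays in the domain.\<close>
    define \<eta> where "\<eta> t = \<gamma> (max 0 (min l t))" for t
    have in\<Omega>: "\<eta> t \<in> \<Omega>" for t unfolding \<eta>_def using \<gamma>(2) l by auto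
    have Lip: "dist (\<eta> s) (\<eta> t) \<le> \<bar>s - t\<bar>" for s t
    proof (induction s t rule: linorder_wlog)
      case (le s t)
      then show ?case
        using arclength_parametrized_Lipschitz[OF \<gamma>(1), of "max 0 (min l s)" "max 0 (min l t)"] l
        unfolding \<eta>_def by (auto simp: max_def min_def split: if_splits)
    qed (simp add: dist_commute abs_minus_commute)
    have "continuous_on UNIV \<eta>"
      by (rule lipschitz_on_continuous_on[of 1], rule lipschitz_onI) (use Lip in \<open>simp_all add: dist_real_def\<close>)
    then have [measurable]: "\<eta> \<in> borel_measurable borel" by (rule borel_measurable_continuous_onI)
    have [measurable]: "(\<lambda>y. cmod (deriv g y) * indicator \<Omega> y) \<in> borel_measurable borel"
      using \<Omega> g' by (intro borel_measurable_indicator_norm holomorphic_on_imp_continuous_on) auto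
    define F :: "real \<Rightarrow> complex \<Rightarrow> ennreal" where "F t y = (if dist (\<eta> t) y < bdist \<Omega> (\<eta> t) / 2 \<and> 0 < t \<and> t \<le> l
        then ennreal (1024 / (bdist \<Omega> (\<eta> t))\<^sup>2) * ennreal (cmod (deriv g y) * indicator \<Omega> y) else 0)" for t y
    have mF: "case_prod F \<in> borel_measurable (lborel \<Otimes>\<^sub>M lborel)"
      unfolding F_def by measurable
    have "ennreal (cmod (g x - g x0)) = ennreal (cmod (g (\<eta> l) - g (\<eta> 0)))"
      using l by (simp add: \<eta>_def \<gamma> norm_minus_commute)
    also have "\<dots> \<le> (\<integral>\<^sup>+t. disc_average \<Omega> (deriv g) (\<eta> t) * indicator {0<..l} t \<partial>lborel)"
      by (rule curve_increment_le[OF \<Omega> g Lip in\<Omega> l])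
    also have "\<dots> = (\<integral>\<^sup>+t. \<integral>\<^sup>+y. F t y \<partial>lborel \<partial>lborel)"
    proof (rule nn_integral_cong)
      fix t
      show "disc_average \<Omega> (deriv g) (\<eta> t) * indicator {0<..l} t = (\<integral>\<^sup>+y. F t y \<partial>lborel)"
      proof (cases "0 < t \<and> t \<le> l")
        case True
        then have "disc_average \<Omega> (deriv g) (\<eta> t) * indicator {0<..l} t = disc_average \<Omega> (deriv g) (\<eta> t)" by simp
        also have "\<dots> = (\<integral>\<^sup>+y. ennreal (1024 / (bdist \<Omega> (\<eta> t))\<^sup>2) * (if dist (\<eta> t) y < bdist \<Omega> (\<eta> t) / 2 then ennreal (cmod (deriv g y) * indicator \<Omega> y) else 0) \<partial>lborel)"
          unfolding disc_average_def by (rule nn_integral_cmult[symmetric]) measurable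
        also have "\<dots> = (\<integral>\<^sup>+y. F t y \<partial>lborel)"
          using True by (intro nn_integral_cong) (simp add: F_def)
        finally show ?thesis .
      qed (auto simp: F_def)
    qed
    also have "\<dots> = (\<integral>\<^sup>+y. \<integral>\<^sup>+t. F t y \<partial>lborel \<partial>lborel)"
      by (rule lborel_pair.Fubini'[OF mF, symmetric])
    also have "\<dots> \<le> (\<integral>\<^sup>+y. ennreal (A * cmod (deriv g y) / bdist \<Omega> y * indicator \<Omega> y * indicator {y. dist x y \<le> K * bdist \<Omega> y} y) \<partial>lborel)"
    proof (rule nn_integral_mono)
      fix y
      show "(\<integral>\<^sup>+t. F t y \<partial>lborel) \<le> ennreal (A * cmod (deriv g y) / bdist \<Omega> y * indicator \<Omega> y * indicator {y. dist x y \<le> K * bdist \<Omega> y} y)"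
      proof (cases "y \<in> \<Omega>")
        case True
        define d where "d = bdist \<Omega> y"
        have d: "0 < d" unfolding d_def by (rule bdist_pos[OF \<Omega> True])
        define G where "G = 2304 / d\<^sup>2 * cmod (deriv g y) * indicator {y. dist x y \<le> K * bdist \<Omega> y} y"
        have G: "0 \<le> G" by (simp add: G_def)
        \<comment> \<open>The disc at time t contains y only if c * t \<le> delta(curve point) \<le>
          2 delta(y). Such times fill a length of order delta(y), which turns 1 / delta^2 into 1 /
          delta.\<close>
        have "(\<integral>\<^sup>+t. F t y \<partial>lborel) \<le> (\<integral>\<^sup>+t. ennreal G * indicator {0..2 * d / c} t \<partial>lborel)"
        proof (rule nn_integral_mono)
          fix t
          show "F t y \<le> ennreal G * indicator {0..2 * d / c} t"
          proof (cases "dist (\<eta> t) y < bdist \<Omega> (\<eta> t) / 2 \<and> 0 < t \<and> t \<le> l")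
            case t: True
            define e where "e = bdist \<Omega> (\<eta> t)"
            have e: "0 < e" unfolding e_def by (rule bdist_pos[OF \<Omega> in\<Omega>])
            have de: "d \<le> 3 / 2 * e" "e \<le> 2 * d"
              using bdist_Lipschitz[of \<Omega> "\<eta> t" y] t unfolding d_def e_def by linarith+
            have "c * t \<le> e" using \<gamma>(5)[of t] t by (simp add: e_def \<eta>_def)
            then have t2: "t \<le> 2 * d / c" using de c by (simp add: field_simps)
            have "dist x y \<le> dist (\<eta> 0) (\<eta> t) + dist (\<eta> t) y"
              using dist_triangle[of x y "\<eta> t"] l by (simp add: \<eta>_def \<gamma>)
            also have "\<dots> \<le> 2 * d / c + d" using Lip[of 0 t] t t2 de unfolding e_def by simp
            finally have cone: "dist x y \<le> K * bdist \<Omega> y" by (simp add: K_def d_def algebra_simps)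
            have "d\<^sup>2 \<le> (3 / 2 * e)\<^sup>2" using de d by (intro power_mono) auto
            then have "1024 / e\<^sup>2 \<le> 2304 / d\<^sup>2" using d e by (simp add: field_simps power2_eq_square)
            then have "1024 / e\<^sup>2 * cmod (deriv g y) \<le> 2304 / d\<^sup>2 * cmod (deriv g y)"
              by (intro mult_right_mono) auto
            then show ?thesis
              using t t2 cone True by (simp add: F_def G_def e_def[symmetric] ennreal_mult'[symmetric] ennreal_leI)
          qed (auto simp: F_def)
        qed
        also have "\<dots> = ennreal (G * (2 * d / c))"
          using d c G by (subst nn_integral_cmult_indicator) (auto simp: ennreal_mult'[symmetric])
        also have "G * (2 * d / c) = A * cmod (deriv g y) / bdist \<Omega> y * indicator \<Omega> y * indicator {y. dist x y \<le> K * bdist \<Omega> y} y"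
          using True d c by (simp add: G_def A_def d_def[symmetric] power2_eq_square mult_ac)
        finally show ?thesis .
      next
        case False
        then have "F t y = 0" for t by (simp add: F_def)
        then show ?thesis by simp
      qed
    qed
    finally show "ennreal (cmod (g x - g x0)) \<le>
       (\<integral>\<^sup>+y. ennreal (A * cmod (deriv g y) / bdist \<Omega> y * indicator \<Omega> y * indicator {y. dist x y \<le> K * bdist \<Omega> y} y) \<partial>lborel)" .
  qed
qed

section \<open>Weighted Poincare inequality\<close>

lemma powr_sum3_le:
  fixes a b c p :: real
  assumes "0 \<le> a" "0 \<le> b" "0 \<le> c" "0 < p"
  shows "(a + b + c) powr p \<le> 3 powr p * (a powr p + (b powr p + c powr p))"
proof -
  define M where "M = max a (max b c)"
  have "(a + b + c) powr p \<le> (3 * M) powr p"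
    using assms by (intro powr_mono2) (auto simp: M_def)
  also have "\<dots> = 3 powr p * M powr p" using assms by (simp add: powr_mult M_def)
  also have "M powr p \<le> a powr p + (b powr p + c powr p)"
    using assms by (auto simp: M_def max_def add_nonneg_nonneg)
  finally show ?thesis by simp
qed

text \<open>\<open>g\<close> is split into g - g(x0), g(x0) - g(z0) and g(z0). The cone estimate
  \<open>star\<close> controls the first after integration and the second at the single point z0;
  the two constants are integrable because the weight delta^a has finite total mass.\<close>

lemma john_weighted_Poincare:
  assumes john: "bounded_john_domain \<Omega>" and z0: "z0 \<in> \<Omega>" and p: "1 < p"
    and s: "assouad_bound (frontier \<Omega>) s" "s < a + 2"
  obtains C where "0 < C" "\<And>g. g holomorphic_on \<Omega> \<Longrightarrow>
    weighted_integral \<Omega> p a g \<le> ennreal C * (ennreal (cmod (g z0) powr p) + weighted_integral \<Omega> p (a + p) (deriv g))"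
proof -
  have \<Omega>: "open \<Omega>" "bounded \<Omega>" "\<Omega> \<noteq> {}" using john by (auto simp: bounded_john_domain_def)
  obtain x0 A K where x0: "x0 \<in> \<Omega>" and A: "0 < A" and K: "0 \<le> K" and
    pw: "\<And>g x. g holomorphic_on \<Omega> \<Longrightarrow> x \<in> \<Omega> \<Longrightarrow> ennreal (cmod (g x - g x0)) \<le>
       (\<integral>\<^sup>+y. ennreal (A * cmod (deriv g y) / bdist \<Omega> y * indicator \<Omega> y * indicator {y. dist x y \<le> K * bdist \<Omega> y} y) \<partial>lborel)"
    by (rule john_pointwise_bound[OF john]) blast
  \<comment> \<open>any \<open>\<sigma> > 0\<close> with \<open>s < a + 2 - \<sigma> (p - 1)\<close> would do\<close>
  define \<sigma> where "\<sigma> = (a + 2 - s) / 2 / (p - 1)"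
  define \<beta> where "\<beta> = a - \<sigma> * (p - 1)"
  have \<sigma>: "0 < \<sigma>" using s p by (simp add: \<sigma>_def)
  have sp: "\<sigma> * (p - 1) = (a + 2 - s) / 2" using p by (simp add: \<sigma>_def field_simps)
  have \<beta>: "s < \<beta> + 2" using s(2) unfolding \<beta>_def sp by (simp add: field_simps)
  have s0: "0 \<le> s" using s by (simp add: assouad_bound_def)
  note front = frontier_closed[of \<Omega>]
  obtain CE where CE: "0 < CE" and E: "\<And>w R. w \<in> frontier \<Omega> \<Longrightarrow> 0 < R \<Longrightarrow>
    (\<integral>\<^sup>+x. ennreal (infdist x (frontier \<Omega>) powr \<beta> * indicator (ball w R) x) \<partial>lborel) \<le> ennreal (CE * R powr (\<beta> + 2))"
    by (rule assouad_weight_integral[OF s(1) front \<beta>]) blast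
  obtain CF where CF: "0 < CF" and F: "\<And>w R. w \<in> frontier \<Omega> \<Longrightarrow> 0 < R \<Longrightarrow>
    (\<integral>\<^sup>+x. ennreal (infdist x (frontier \<Omega>) powr a * indicator (ball w R) x) \<partial>lborel) \<le> ennreal (CF * R powr (a + 2))"
    by (rule assouad_weight_integral[OF s(1) front s(2)]) blast
  define B where "B = pi * (2 + 2 * K) powr (\<sigma> + 2) / (1 - 2 powr (-\<sigma>))"
  have "2 powr (-\<sigma>) < (2::real) powr 0" using \<sigma> by (intro powr_less_mono) auto
  then have B: "0 < B" using K by (simp add: B_def)
  define C1 where "C1 = B powr (p - 1) * A powr p"
  have C1: "0 < C1" using A B by (simp add: C1_def)
  \<comment> \<open>The exponent is (\<sigma>+1) p - \<sigma> - 2, that of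
    \<open>u powr p * w\<close> in the proof of \<open>star\<close>.\<close>
  define h where "h g y = cmod (deriv g y) powr p * bdist \<Omega> y powr (p - 2 + \<sigma> * (p - 1)) * indicator \<Omega> y" for g y
  define H where "H g x = (\<integral>\<^sup>+y. ennreal (h g y) * indicator {y. dist x y \<le> K * bdist \<Omega> y} y \<partial>lborel)" for g x
  have mh: "h g \<in> borel_measurable borel" if "g holomorphic_on \<Omega>" for g
    using borel_measurable_weighted[OF \<Omega>(1) holomorphic_deriv[OF that \<Omega>(1)]]
    by (simp add: h_def[abs_def])
  have star: "ennreal (cmod (g x - g x0) powr p) \<le> ennreal (C1 * bdist \<Omega> x powr (- \<sigma> * (p - 1))) * H g x"
    if g: "g holomorphic_on \<Omega>" and x: "x \<in> \<Omega>" for g x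
  proof -
    define S where "S = {y. dist x y \<le> K * bdist \<Omega> y}"
    have "closed S" unfolding S_def by (intro closed_Collect_le continuous_intros)
    then have [measurable]: "S \<in> sets borel" by simp
    have [measurable]: "\<Omega> \<in> sets borel" using \<Omega> by simp
    have [measurable]: "(\<lambda>y. cmod (deriv g y) * indicator \<Omega> y) \<in> borel_measurable borel"
      using \<Omega> holomorphic_deriv[OF g \<Omega>(1)] by (intro borel_measurable_indicator_norm holomorphic_on_imp_continuous_on) auto
    \<comment> \<open>The product \<open>u * w\<close> is the integrand of the pointwise bound, and
      \<open>w\<close> is the weight whose mass over the cone is known.\<close>
    define u where "u y = A * (cmod (deriv g y) * indicator \<Omega> y) * bdist \<Omega> y powr (\<sigma> + 1)" for y
    define w where "w y = bdist \<Omega> y powr (-\<sigma>-2) * indicator \<Omega> y * indicator S y" for y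
    have mu: "u \<in> borel_measurable lborel" "w \<in> borel_measurable lborel"
      unfolding u_def w_def by measurable
    have dx: "0 < bdist \<Omega> x" by (rule bdist_pos[OF \<Omega>(1,2) x])
    have "ennreal (cmod (g x - g x0) powr p)
        \<le> ennreal ((B * bdist \<Omega> x powr (-\<sigma>)) powr (p - 1)) * (\<integral>\<^sup>+y. ennreal (u y powr p * w y) \<partial>lborel)"
    proof (rule nn_integral_powr_Jensen[OF p _ _ mu])
      show "0 < B * bdist \<Omega> x powr (-\<sigma>)" using B dx by simp
      show "0 \<le> u y" "0 \<le> w y" for y using A by (simp_all add: u_def w_def)
      show "(\<integral>\<^sup>+y. ennreal (w y) \<partial>lborel) \<le> ennreal (B * bdist \<Omega> x powr (-\<sigma>))"
        unfolding w_def S_def B_def by (rule cone_weight_integral[OF \<Omega>(1,2) x K \<sigma>])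
      have "u y * w y = A * cmod (deriv g y) / bdist \<Omega> y * indicator \<Omega> y * indicator S y" for y
      proof (cases "y \<in> \<Omega>")
        case True
        have "0 < bdist \<Omega> y" by (rule bdist_pos[OF \<Omega>(1,2) True])
        then have "bdist \<Omega> y powr (\<sigma> + 1) * bdist \<Omega> y powr (-\<sigma>-2) = 1 / bdist \<Omega> y"
          by (simp add: powr_add[symmetric] powr_minus_divide)
        then have "A * cmod (deriv g y) * indicator S y * (bdist \<Omega> y powr (\<sigma> + 1) * bdist \<Omega> y powr (-\<sigma>-2))
          = A * cmod (deriv g y) * indicator S y * (1 / bdist \<Omega> y)" by simp
        then show ?thesis using True by (simp add: u_def w_def mult_ac)
      qed (simp add: w_def)
      then show "ennreal (cmod (g x - g x0)) \<le> (\<integral>\<^sup>+y. ennreal (u y * w y) \<partial>lborel)"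
        using pw[OF g x] by (simp add: S_def)
    qed simp
    also have "(\<integral>\<^sup>+y. ennreal (u y powr p * w y) \<partial>lborel) = (\<integral>\<^sup>+y. ennreal (A powr p) * (ennreal (h g y) * indicator S y) \<partial>lborel)"
    proof (rule nn_integral_cong)
      fix y
      show "ennreal (u y powr p * w y) = ennreal (A powr p) * (ennreal (h g y) * indicator S y)"
      proof (cases "y \<in> \<Omega> \<and> y \<in> S")
        case True
        then have dy: "0 < bdist \<Omega> y" by (intro bdist_pos \<Omega>) auto
        have "u y powr p * w y = A powr p * cmod (deriv g y) powr p * (bdist \<Omega> y powr ((\<sigma> + 1) * p) * bdist \<Omega> y powr (-\<sigma>-2))"
          using True A by (simp add: u_def w_def powr_mult powr_powr)
        also have "bdist \<Omega> y powr ((\<sigma> + 1) * p) * bdist \<Omega> y powr (-\<sigma>-2) = bdist \<Omega> y powr (p - 2 + \<sigma> * (p - 1))"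
          by (simp add: powr_add[symmetric] algebra_simps)
        finally show ?thesis using True by (simp add: h_def ennreal_mult'[symmetric] mult.assoc)
      qed (auto simp: h_def w_def)
    qed
    also have "\<dots> = ennreal (A powr p) * H g x"
      unfolding H_def S_def[symmetric]
      by (intro nn_integral_cmult borel_measurable_times_ennreal borel_measurable_indicator measurable_compose[OF _ measurable_ennreal])
        (simp_all add: mh g \<open>closed S\<close>)
    also have "ennreal ((B * bdist \<Omega> x powr (-\<sigma>)) powr (p - 1)) * (ennreal (A powr p) * H g x)
        = ennreal ((B * bdist \<Omega> x powr (-\<sigma>)) powr (p - 1) * A powr p) * H g x"
      by (rule ennreal_mult_ennreal_mult) simp
    also have "(B * bdist \<Omega> x powr (-\<sigma>)) powr (p - 1) * A powr p = C1 * bdist \<Omega> x powr (- \<sigma> * (p - 1))"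
      using B by (simp add: C1_def powr_mult powr_powr)
    finally show ?thesis .
  qed
  define C2 where "C2 = C1 * CE * (K + 2) powr (\<beta> + 2)"
  have C2: "0 < C2" using C1 CE K by (simp add: C2_def)
  have I1: "weighted_integral \<Omega> p a (\<lambda>x. g x - g x0) \<le> ennreal C2 * weighted_integral \<Omega> p (a + p) (deriv g)"
    if g: "g holomorphic_on \<Omega>" for g
  proof -
    note mh[OF g, measurable]
    have [measurable]: "\<Omega> \<in> sets borel" using \<Omega> by simp
    define k where "k x = ennreal (C1 * bdist \<Omega> x powr \<beta> * indicator \<Omega> x)" for x
    have [measurable]: "k \<in> borel_measurable borel" unfolding k_def by measurable
    have "weighted_integral \<Omega> p a (\<lambda>x. g x - g x0) \<le> (\<integral>\<^sup>+x. k x * H g x \<partial>lborel)"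
      unfolding weighted_integral_def
    proof (rule nn_integral_mono)
      fix x
      show "ennreal (cmod (g x - g x0) powr p * bdist \<Omega> x powr a * indicator \<Omega> x) \<le> k x * H g x"
      proof (cases "x \<in> \<Omega>")
        case True
        have "ennreal (cmod (g x - g x0) powr p * bdist \<Omega> x powr a * indicator \<Omega> x)
          = ennreal (bdist \<Omega> x powr a) * ennreal (cmod (g x - g x0) powr p)"
          using True by (simp add: ennreal_mult'[symmetric] mult.commute)
        also have "\<dots> \<le> ennreal (bdist \<Omega> x powr a) * (ennreal (C1 * bdist \<Omega> x powr (- \<sigma> * (p - 1))) * H g x)"
          by (intro mult_left_mono star[OF g True]) simp
        also have "\<dots> = ennreal (C1 * (bdist \<Omega> x powr a * bdist \<Omega> x powr (- \<sigma> * (p - 1)))) * H g x"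
          by (subst ennreal_mult_ennreal_mult) (simp_all add: mult_ac)
        also have "bdist \<Omega> x powr a * bdist \<Omega> x powr (- \<sigma> * (p - 1)) = bdist \<Omega> x powr \<beta>"
          by (simp add: powr_add[symmetric] \<beta>_def)
        finally show ?thesis using True by (simp add: k_def)
      qed simp
    qed
    also have "\<dots> = (\<integral>\<^sup>+y. ennreal (h g y) * (\<integral>\<^sup>+x. k x * indicator (cball y (K * bdist \<Omega> y)) x \<partial>lborel) \<partial>lborel)"
      unfolding H_def by (rule Tonelli_cone) measurable
    also have "\<dots> \<le> (\<integral>\<^sup>+y. ennreal C2 * ennreal (cmod (deriv g y) powr p * bdist \<Omega> y powr (a + p) * indicator \<Omega> y) \<partial>lborel)"
    proof (rule nn_integral_mono)
      fix y
      show "ennreal (h g y) * (\<integral>\<^sup>+x. k x * indicator (cball y (K * bdist \<Omega> y)) x \<partial>lborel)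
        \<le> ennreal C2 * ennreal (cmod (deriv g y) powr p * bdist \<Omega> y powr (a + p) * indicator \<Omega> y)"
      proof (cases "y \<in> \<Omega>")
        case True
        define d where "d = bdist \<Omega> y"
        have d: "0 < d" unfolding d_def by (rule bdist_pos[OF \<Omega>(1,2) True])
        obtain v where v: "v \<in> frontier \<Omega>" "d = dist y v" unfolding d_def by (rule bdist_attained[OF \<Omega>(2,3)])
        \<comment> \<open>The Assouad estimate concerns balls centred on the boundary, so the disc
          around y is enlarged to a ball around the nearest boundary point.\<close>
        have sub: "cball y (K * d) \<subseteq> ball v ((K + 2) * d)"
        proof
          fix x assume "x \<in> cball y (K * d)"
          then have "dist v x \<le> d + K * d" using dist_triangle[of v x y] v by (simp add: dist_commute)
          also have "\<dots> < (K + 2) * d" using d by (simp add: algebra_simps)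
          finally show "x \<in> ball v ((K + 2) * d)" by simp
        qed
        have "(\<integral>\<^sup>+x. k x * indicator (cball y (K * d)) x \<partial>lborel)
          \<le> (\<integral>\<^sup>+x. ennreal C1 * ennreal (infdist x (frontier \<Omega>) powr \<beta> * indicator (ball v ((K + 2) * d)) x) \<partial>lborel)"
          using sub C1 by (intro nn_integral_mono) (auto simp: k_def indicator_def bdist_def ennreal_mult'[symmetric] subset_iff)
        also have "\<dots> = ennreal C1 * (\<integral>\<^sup>+x. ennreal (infdist x (frontier \<Omega>) powr \<beta> * indicator (ball v ((K + 2) * d)) x) \<partial>lborel)"
        proof (rule nn_integral_cmult)
          have mb: "(\<lambda>x. bdist \<Omega> x powr \<beta>) \<in> borel_measurable borel" by measurable
          have "(\<lambda>x. bdist \<Omega> x powr \<beta> * indicator (ball v ((K + 2) * d)) x) \<in> borel_measurable borel"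
            by (intro borel_measurable_times borel_measurable_indicator borel_open) (simp_all add: mb)
          then show "(\<lambda>x. ennreal (infdist x (frontier \<Omega>) powr \<beta> * indicator (ball v ((K + 2) * d)) x)) \<in> borel_measurable lborel"
            unfolding bdist_def by simp
        qed
        also have "\<dots> \<le> ennreal C1 * ennreal (CE * ((K + 2) * d) powr (\<beta> + 2))"
          using d K by (intro mult_left_mono E v) auto
        also have "\<dots> = ennreal (C2 * d powr (\<beta> + 2))"
          using C1 d K by (simp add: C2_def ennreal_mult'[symmetric] powr_mult mult_ac)
        finally have le: "(\<integral>\<^sup>+x. k x * indicator (cball y (K * d)) x \<partial>lborel) \<le> ennreal (C2 * d powr (\<beta> + 2))" .
        have "ennreal (h g y) * (\<integral>\<^sup>+x. k x * indicator (cball y (K * bdist \<Omega> y)) x \<partial>lborel) \<le> ennreal (h g y) * ennreal (C2 * d powr (\<beta> + 2))"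
          unfolding d_def[symmetric] by (rule mult_left_mono[OF le]) simp
        also have "\<dots> = ennreal (C2 * (cmod (deriv g y) powr p * (d powr (p - 2 + \<sigma> * (p - 1)) * d powr (\<beta> + 2))))"
          using True C2 by (simp add: h_def d_def[symmetric] ennreal_mult'[symmetric] mult_ac)
        also have "d powr (p - 2 + \<sigma> * (p - 1)) * d powr (\<beta> + 2) = d powr (a + p)"
          by (simp add: powr_add[symmetric] \<beta>_def algebra_simps)
        finally show ?thesis using True C2 by (simp add: d_def ennreal_mult'[symmetric])
      qed (simp add: h_def)
    qed
    also have "\<dots> = ennreal C2 * weighted_integral \<Omega> p (a + p) (deriv g)"
      unfolding weighted_integral_def using borel_measurable_weighted[OF \<Omega>(1) holomorphic_deriv[OF g \<Omega>(1)]]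
      by (intro nn_integral_cmult) simp
    finally show ?thesis .
  qed
  \<comment> \<open>A lower bound for delta on the cone at z0. The factor delta^(-(\<beta>+2)), by
    which \<open>h\<close> differs from the target weight, is thus bounded there, as \<beta> + 2 > s
    \<ge> 0.\<close>
  define e where "e = bdist \<Omega> z0 / (1 + K)"
  have dz: "0 < bdist \<Omega> z0" by (rule bdist_pos[OF \<Omega>(1,2) z0])
  have e: "0 < e" using dz K by (simp add: e_def)
  define C3 where "C3 = C1 * bdist \<Omega> z0 powr (- \<sigma> * (p - 1)) * e powr (-(\<beta> + 2))"
  have C3: "0 < C3" using C1 dz e by (simp add: C3_def)
  have I2: "ennreal (cmod (g z0 - g x0) powr p) \<le> ennreal C3 * weighted_integral \<Omega> p (a + p) (deriv g)"
    if g: "g holomorphic_on \<Omega>" for g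
  proof -
    have "H g z0 \<le> (\<integral>\<^sup>+y. ennreal (e powr (-(\<beta> + 2))) * ennreal (cmod (deriv g y) powr p * bdist \<Omega> y powr (a + p) * indicator \<Omega> y) \<partial>lborel)"
      unfolding H_def
    proof (rule nn_integral_mono)
      fix y
      show "ennreal (h g y) * indicator {y. dist z0 y \<le> K * bdist \<Omega> y} y
         \<le> ennreal (e powr (-(\<beta> + 2))) * ennreal (cmod (deriv g y) powr p * bdist \<Omega> y powr (a + p) * indicator \<Omega> y)"
      proof (cases "y \<in> \<Omega> \<and> dist z0 y \<le> K * bdist \<Omega> y")
        case True
        have "bdist \<Omega> z0 \<le> (1 + K) * bdist \<Omega> y"
          using abs_le_D1[OF bdist_Lipschitz[of \<Omega> z0 y]] True unfolding distrib_right by simp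
        then have "e \<le> bdist \<Omega> y" using K by (simp add: e_def divide_le_eq mult.commute)
        then have "bdist \<Omega> y powr (-(\<beta> + 2)) \<le> e powr (-(\<beta> + 2))"
          using e \<beta> s0 by (intro powr_mono2') auto
        then have "cmod (deriv g y) powr p * bdist \<Omega> y powr (a + p) * bdist \<Omega> y powr (-(\<beta> + 2))
           \<le> cmod (deriv g y) powr p * bdist \<Omega> y powr (a + p) * e powr (-(\<beta> + 2))"
          by (intro mult_left_mono) auto
        moreover have "bdist \<Omega> y powr (a + p) * bdist \<Omega> y powr (-(\<beta> + 2)) = bdist \<Omega> y powr (p - 2 + \<sigma> * (p - 1))"
          by (simp add: powr_add[symmetric] \<beta>_def algebra_simps)
        ultimately show ?thesis using True by (simp add: h_def ennreal_mult'[symmetric] ennreal_leI mult_ac)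
      qed (auto simp: h_def)
    qed
    also have "\<dots> = ennreal (e powr (-(\<beta> + 2))) * weighted_integral \<Omega> p (a + p) (deriv g)"
      unfolding weighted_integral_def using borel_measurable_weighted[OF \<Omega>(1) holomorphic_deriv[OF g \<Omega>(1)]]
      by (intro nn_integral_cmult) simp
    finally have Hz: "H g z0 \<le> \<dots>" .
    have "ennreal (cmod (g z0 - g x0) powr p) \<le> ennreal (C1 * bdist \<Omega> z0 powr (- \<sigma> * (p - 1))) * H g z0"
      by (rule star[OF g z0])
    also have "\<dots> \<le> ennreal (C1 * bdist \<Omega> z0 powr (- \<sigma> * (p - 1))) * (ennreal (e powr (-(\<beta> + 2))) * weighted_integral \<Omega> p (a + p) (deriv g))"
      by (rule mult_left_mono[OF Hz]) simp
    also have "\<dots> = ennreal C3 * weighted_integral \<Omega> p (a + p) (deriv g)"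
      unfolding C3_def by (rule ennreal_mult_ennreal_mult) (use C1 in simp)
    finally show ?thesis .
  qed
  \<comment> \<open>Finite total mass of the weight: the bounded domain lies in one ball centred at
    a boundary point, and a + 2 > s.\<close>
  obtain C4 where C4: "0 < C4" and I3: "(\<integral>\<^sup>+x. ennreal (bdist \<Omega> x powr a * indicator \<Omega> x) \<partial>lborel) \<le> ennreal C4"
  proof -
    obtain v where v: "v \<in> frontier \<Omega>" using frontier_bounded_open_nonempty[OF \<Omega>(2,3)] by blast
    obtain R where R: "0 < R" "\<Omega> \<subseteq> ball v R" using bounded_subset_ballD[OF \<Omega>(2)] by blast
    have "(\<integral>\<^sup>+x. ennreal (bdist \<Omega> x powr a * indicator \<Omega> x) \<partial>lborel)
       \<le> (\<integral>\<^sup>+x. ennreal (infdist x (frontier \<Omega>) powr a * indicator (ball v R) x) \<partial>lborel)"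
      using R by (intro nn_integral_mono) (auto simp: bdist_def indicator_def subset_iff)
    also have "\<dots> \<le> ennreal (CF * R powr (a + 2))" by (rule F[OF v R(1)])
    finally show ?thesis using that[of "CF * R powr (a + 2)"] CF R by simp
  qed
  define C where "C = 3 powr p * (C2 + C4 * (C3 + 1))"
  show ?thesis
  proof (rule that[of C])
    show "0 < C" using C2 C3 C4 by (simp add: C_def add_pos_pos)
    fix g assume g: "g holomorphic_on \<Omega>"
    define W where "W = weighted_integral \<Omega> p (a + p) (deriv g)"
    define T where "T = cmod (g z0 - g x0) powr p + cmod (g z0) powr p"
    have T: "0 \<le> T" by (simp add: T_def)
    have [measurable]: "\<Omega> \<in> sets borel" using \<Omega> by simp
    have gx: "(\<lambda>x. g x - g x0) holomorphic_on \<Omega>" by (intro holomorphic_intros g)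
    define G where "G x = ennreal (cmod (g x - g x0) powr p * bdist \<Omega> x powr a * indicator \<Omega> x)" for x
    have [measurable]: "G \<in> borel_measurable borel"
      using borel_measurable_weighted[OF \<Omega>(1) gx] unfolding G_def by measurable
    have "weighted_integral \<Omega> p a g \<le> (\<integral>\<^sup>+x. ennreal (3 powr p) * (G x + ennreal T * ennreal (bdist \<Omega> x powr a * indicator \<Omega> x)) \<partial>lborel)"
      unfolding weighted_integral_def
    proof (rule nn_integral_mono)
      fix x
      have "cmod (g x) \<le> cmod (g x - g x0) + cmod (g z0 - g x0) + cmod (g z0)"
        using norm_triangle_ineq[of "g x - g x0" "g z0 - (g z0 - g x0)"] norm_triangle_ineq4[of "g z0" "g z0 - g x0"] by simp
      then have "cmod (g x) powr p \<le> (cmod (g x - g x0) + cmod (g z0 - g x0) + cmod (g z0)) powr p"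
        using p by (intro powr_mono2) auto
      also have "\<dots> \<le> 3 powr p * (cmod (g x - g x0) powr p + T)"
        unfolding T_def using p by (intro powr_sum3_le) auto
      finally have "cmod (g x) powr p * (bdist \<Omega> x powr a * indicator \<Omega> x) \<le> 3 powr p * (cmod (g x - g x0) powr p + T) * (bdist \<Omega> x powr a * indicator \<Omega> x)"
        by (intro mult_right_mono) auto
      also have "\<dots> = 3 powr p * (cmod (g x - g x0) powr p * bdist \<Omega> x powr a * indicator \<Omega> x + T * (bdist \<Omega> x powr a * indicator \<Omega> x))"
        by (simp add: algebra_simps)
      finally have "ennreal (cmod (g x) powr p * bdist \<Omega> x powr a * indicator \<Omega> x) \<le> ennreal \<dots>"
        by (intro ennreal_leI) (simp add: mult.assoc)
      also have "\<dots> = ennreal (3 powr p) * (G x + ennreal T * ennreal (bdist \<Omega> x powr a * indicator \<Omega> x))"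
        using T by (simp add: G_def ennreal_mult'[symmetric] ennreal_plus[symmetric] del: ennreal_plus)
      finally show "ennreal (cmod (g x) powr p * bdist \<Omega> x powr a * indicator \<Omega> x) \<le> \<dots>" .
    qed
    also have "\<dots> = ennreal (3 powr p) * (weighted_integral \<Omega> p a (\<lambda>x. g x - g x0) + ennreal T * (\<integral>\<^sup>+x. ennreal (bdist \<Omega> x powr a * indicator \<Omega> x) \<partial>lborel))"
      by (simp add: nn_integral_cmult nn_integral_add weighted_integral_def G_def[symmetric])
    also have "\<dots> \<le> ennreal (3 powr p) * (ennreal C2 * W + ennreal T * ennreal C4)"
      using I1[OF g] I3 unfolding W_def by (intro mult_left_mono add_mono) auto
    also have "\<dots> \<le> ennreal (3 powr p) * (ennreal C2 * W + (ennreal C3 * W + ennreal (cmod (g z0) powr p)) * ennreal C4)"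
      using I2[OF g] unfolding W_def T_def by (intro mult_left_mono add_mono mult_right_mono) (auto simp: ennreal_plus)
    also have "\<dots> = ennreal (3 powr p * (C2 + C4 * C3)) * W + ennreal (3 powr p * C4) * ennreal (cmod (g z0) powr p)"
      using C2 C3 C4 by (simp add: ennreal_mult ennreal_plus algebra_simps)
    also have "\<dots> \<le> ennreal C * W + ennreal C * ennreal (cmod (g z0) powr p)"
      using C2 C3 C4 by (intro add_mono mult_right_mono ennreal_leI) (auto simp: C_def algebra_simps)
    finally show "weighted_integral \<Omega> p a g \<le> ennreal C * (ennreal (cmod (g z0) powr p) + W)"
      by (simp add: distrib_left add.commute)
  qed
qed

section \<open>Induction on the order of the derivative\<close>

lemma deriv_integral_eq_weighted:
  "deriv_integral \<Omega> p k f = weighted_integral \<Omega> p (real k * p - 2) ((deriv ^^ k) f)"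
  unfolding deriv_integral_def weighted_integral_def
  by (intro nn_integral_cong) (auto simp: indicator_def)

text \<open>Starting the induction at N = m makes the sum empty and both sides equal. Each step
  trades the integral of order N for the point value of order N and the integral of order N + 1,
  multiplying the constant by a factor that does not depend on \<open>f\<close>.\<close>

lemma derivative_characterization:
  assumes john: "bounded_john_domain \<Omega>" and z0: "z0 \<in> \<Omega>" and p: "1 < p"
    and s: "assouad_bound (frontier \<Omega>) s" "s < real m * p" and mN: "m \<le> N"
  shows "\<exists>C\<ge>1. \<forall>f. f analytic_on \<Omega> \<longrightarrow>
        deriv_integral \<Omega> p m f
          \<le> ennreal C * (ennreal (\<Sum>k=m..<N. cmod ((deriv ^^ k) f z0) powr p * bdist \<Omega> z0 powr (real k * p)) + deriv_integral \<Omega> p N f) \<and>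
        ennreal (\<Sum>k=m..<N. cmod ((deriv ^^ k) f z0) powr p * bdist \<Omega> z0 powr (real k * p)) + deriv_integral \<Omega> p N f
          \<le> ennreal C * deriv_integral \<Omega> p m f"
  using mN
proof (induction N rule: dec_induct)
  case base
  show ?case by (intro exI[of _ 1]) simp
next
  case (step N)
  have \<Omega>: "open \<Omega>" "bounded \<Omega>" using john by (auto simp: bounded_john_domain_def)
  define a where "a = real N * p - 2"
  define S where "S n f = (\<Sum>k=m..<n. cmod ((deriv ^^ k) f z0) powr p * bdist \<Omega> z0 powr (real k * p))" for n f
  define D where "D = bdist \<Omega> z0 powr (real N * p)"
  have D: "0 < D" using bdist_pos[OF \<Omega> z0] by (simp add: D_def)
  \<comment> \<open>Higher orders keep the exponent condition, so the Poincare inequality applies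
    with the same \<open>s\<close>.\<close>
  have "real m * p \<le> real N * p" using step p by (intro mult_right_mono) auto
  then have sa: "s < a + 2" using s by (simp add: a_def)
  obtain C where C: "1 \<le> C" and IH: "\<And>f. f analytic_on \<Omega> \<Longrightarrow>
      deriv_integral \<Omega> p m f \<le> ennreal C * (ennreal (S N f) + deriv_integral \<Omega> p N f) \<and>
      ennreal (S N f) + deriv_integral \<Omega> p N f \<le> ennreal C * deriv_integral \<Omega> p m f"
    using step.IH unfolding S_def by blast
  obtain C1 where C1: "0 < C1" "\<And>g. g holomorphic_on \<Omega> \<Longrightarrow>
    weighted_integral \<Omega> p (a + p) (deriv g) \<le> ennreal C1 * weighted_integral \<Omega> p a g"
    by (rule weighted_integral_deriv_le[OF \<Omega> p]) blast
  obtain C2 where C2: "0 < C2" "\<And>g. g holomorphic_on \<Omega> \<Longrightarrow>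
    ennreal (cmod (g z0) powr p) \<le> ennreal C2 * weighted_integral \<Omega> p a g"
    by (rule point_le_weighted_integral[OF \<Omega> p z0]) blast
  obtain C3 where C3: "0 < C3" "\<And>g. g holomorphic_on \<Omega> \<Longrightarrow>
    weighted_integral \<Omega> p a g \<le> ennreal C3 * (ennreal (cmod (g z0) powr p) + weighted_integral \<Omega> p (a + p) (deriv g))"
    by (rule john_weighted_Poincare[OF john z0 p s(1) sa]) blast
  \<comment> \<open>The first entry serves the upper estimate, the second the lower one. The
    quotient C3 / D appears because the sum carries the point value with the factor
    \<open>D\<close>, the Poincare inequality without it.\<close>
  define L where "L = max (1 + D * C2 + C1) (max 1 (C3 * max 1 (1 / D)))"
  have L: "1 \<le> L" "1 + D * C2 + C1 \<le> L" "C3 \<le> L" "C3 / D \<le> L"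
  proof -
    show "1 \<le> L" "1 + D * C2 + C1 \<le> L" by (auto simp: L_def)
    have "C3 * 1 \<le> C3 * max 1 (1 / D)" "C3 * (1 / D) \<le> C3 * max 1 (1 / D)"
      using C3(1) by (intro mult_left_mono; simp)+
    then show "C3 \<le> L" "C3 / D \<le> L" by (auto simp: L_def)
  qed
  show ?case
  proof (intro exI[of _ "C * L"] conjI allI impI)
    show "1 \<le> C * L" using C L(1) mult_mono[of 1 C 1 L] by simp
    fix f assume f: "f analytic_on \<Omega>"
    define g where "g = (deriv ^^ N) f"
    have g: "g holomorphic_on \<Omega>"
      unfolding g_def using f \<Omega> by (intro holomorphic_higher_deriv) (auto simp: analytic_on_open)
    define x where "x = cmod (g z0) powr p"
    define I where "I = deriv_integral \<Omega> p N f"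
    define J where "J = deriv_integral \<Omega> p (Suc N) f"
    have I: "I = weighted_integral \<Omega> p a g" by (simp add: I_def g_def deriv_integral_eq_weighted a_def)
    have J: "J = weighted_integral \<Omega> p (a + p) (deriv g)"
      by (simp add: J_def g_def deriv_integral_eq_weighted a_def algebra_simps)
    have S: "ennreal (S (Suc N) f) = ennreal (S N f) + ennreal (x * D)"
      using step by (subst ennreal_plus[symmetric]) (auto simp: S_def x_def g_def D_def sum_nonneg)
    have JI: "J \<le> ennreal C1 * I" unfolding I J by (rule C1(2)[OF g])
    have "ennreal (x * D) = ennreal D * ennreal x" using D by (simp add: ennreal_mult'[symmetric] mult.commute)
    also have "\<dots> \<le> ennreal D * (ennreal C2 * I)" unfolding x_def I by (intro mult_left_mono C2(2)[OF g]) simp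
    also have "\<dots> = ennreal (D * C2) * I" by (rule ennreal_mult_ennreal_mult) (use D in simp)
    finally have xI: "ennreal (x * D) \<le> ennreal (D * C2) * I" .
    have "ennreal (S (Suc N) f) + J \<le> ennreal (S N f) + (ennreal (D * C2) * I + ennreal C1 * I)"
      unfolding S add.assoc by (intro add_mono xI JI order_refl)
    also have "\<dots> \<le> ennreal L * ennreal (S N f) + ennreal L * I"
    proof (rule add_mono)
      show "ennreal (S N f) \<le> ennreal L * ennreal (S N f)"
        using L(1) mult_right_mono[of 1 "ennreal L" "ennreal (S N f)"] by simp
      have "ennreal (D * C2) * I + ennreal C1 * I = ennreal (D * C2 + C1) * I"
        using D C2(1) C1(1) by (simp add: ennreal_plus distrib_right)
      also have "\<dots> \<le> ennreal L * I" using L(2) by (intro mult_right_mono ennreal_leI) auto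
      finally show "ennreal (D * C2) * I + ennreal C1 * I \<le> ennreal L * I" .
    qed
    also have "\<dots> = ennreal L * (ennreal (S N f) + I)" by (simp add: distrib_left)
    also have "\<dots> \<le> ennreal L * (ennreal C * deriv_integral \<Omega> p m f)"
      using IH[OF f] unfolding I_def by (intro mult_left_mono) auto
    also have "\<dots> = ennreal (C * L) * deriv_integral \<Omega> p m f"
      using L(1) by (subst ennreal_mult_ennreal_mult) (auto simp: mult.commute)
    finally show "ennreal (\<Sum>k=m..<Suc N. cmod ((deriv ^^ k) f z0) powr p * bdist \<Omega> z0 powr (real k * p)) + deriv_integral \<Omega> p (Suc N) f
        \<le> ennreal (C * L) * deriv_integral \<Omega> p m f"
      by (simp only: S_def[symmetric] J_def[symmetric])
    have "I \<le> ennreal C3 * (ennreal x + J)" unfolding x_def I J by (rule C3(2)[OF g])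
    also have "\<dots> = ennreal (C3 / D) * ennreal (x * D) + ennreal C3 * J"
      using D C3(1) by (simp add: distrib_left ennreal_mult'[symmetric])
    also have "\<dots> \<le> ennreal L * ennreal (x * D) + ennreal L * J"
      using L by (intro add_mono mult_right_mono ennreal_leI) auto
    finally have IJ: "I \<le> ennreal L * (ennreal (x * D) + J)" by (simp add: distrib_left)
    have SL: "ennreal (S N f) \<le> ennreal L * ennreal (S N f)"
      using L(1) mult_right_mono[of 1 "ennreal L" "ennreal (S N f)"] by simp
    have "deriv_integral \<Omega> p m f \<le> ennreal C * (ennreal (S N f) + I)"
      using IH[OF f] unfolding I_def by auto
    also have "\<dots> \<le> ennreal C * (ennreal L * ennreal (S N f) + ennreal L * (ennreal (x * D) + J))"
      by (intro mult_left_mono add_mono SL IJ) simp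
    also have "\<dots> = ennreal C * (ennreal L * (ennreal (S (Suc N) f) + J))"
      by (simp add: S distrib_left add.assoc)
    also have "\<dots> = ennreal (C * L) * (ennreal (S (Suc N) f) + J)"
      by (rule ennreal_mult_ennreal_mult) (use C in simp)
    finally show "deriv_integral \<Omega> p m f \<le> ennreal (C * L) *
        (ennreal (\<Sum>k=m..<Suc N. cmod ((deriv ^^ k) f z0) powr p * bdist \<Omega> z0 powr (real k * p)) + deriv_integral \<Omega> p (Suc N) f)"
      by (simp only: S_def[symmetric] J_def[symmetric])
  qed
qed

theorem corollary1p4:
  fixes \<Omega> :: "complex set" and z0 :: complex and p :: real and m N :: nat
  assumes "bounded_john_domain \<Omega>" and "z0 \<in> \<Omega>" and "1 < p" and "1 \<le> m" and "m < N"
  shows "(assouad_dim (frontier \<Omega>) < ereal (real m * p) \<longrightarrow>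
      (\<exists>C\<ge>1. \<forall>f. f analytic_on \<Omega> \<longrightarrow>
        ennreal (inverse C) * deriv_integral \<Omega> p m f
          \<le> ennreal (\<Sum>k=m..<N. cmod ((deriv ^^ k) f z0) powr p * bdist \<Omega> z0 powr (real k * p))
              + deriv_integral \<Omega> p N f \<and>
        ennreal (\<Sum>k=m..<N. cmod ((deriv ^^ k) f z0) powr p * bdist \<Omega> z0 powr (real k * p))
              + deriv_integral \<Omega> p N f
          \<le> ennreal C * deriv_integral \<Omega> p m f))
    \<and> (2 \<le> m \<longrightarrow>
      (\<exists>C\<ge>1. \<forall>f. f analytic_on \<Omega> \<longrightarrow>
        ennreal (inverse C) * deriv_integral \<Omega> p m f
          \<le> ennreal (\<Sum>k=m..<N. cmod ((deriv ^^ k) f z0) powr p * bdist \<Omega> z0 powr (real k * p))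
              + deriv_integral \<Omega> p N f \<and>
        ennreal (\<Sum>k=m..<N. cmod ((deriv ^^ k) f z0) powr p * bdist \<Omega> z0 powr (real k * p))
              + deriv_integral \<Omega> p N f
          \<le> ennreal C * deriv_integral \<Omega> p m f))" (is "(_ \<longrightarrow> ?Q) \<and> (_ \<longrightarrow> ?Q)")
proof -
  \<comment> \<open>Both claims share this conclusion and differ only in the source of an exponent s
    < m p: the strict bound on the dimension, or s = 2.\<close>
  have main: ?Q if s: "assouad_bound (frontier \<Omega>) s" "s < real m * p" for s
  proof -
    have inv: "ennreal (inverse C) * X \<le> Y" if "X \<le> ennreal C * Y" "1 \<le> C" for C X Y
    proof -
      have "ennreal (inverse C) * X \<le> ennreal (inverse C) * (ennreal C * Y)"
        by (rule mult_left_mono[OF that(1)]) simp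
      also have "\<dots> = ennreal (inverse C * C) * Y"
        by (rule ennreal_mult_ennreal_mult) (use that in simp)
      finally show ?thesis using that by simp
    qed
    show ?thesis
      using derivative_characterization[OF assms(1-3) s less_imp_le[OF assms(5)]] inv by meson
  qed
  show ?thesis
  proof (intro conjI impI)
    assume "assouad_dim (frontier \<Omega>) < ereal (real m * p)"
    then obtain s where "s < real m * p" "assouad_bound (frontier \<Omega>) s" by (rule assouad_dim_less_obtain)
    then show ?Q by (intro main)
  next
    assume m: "2 \<le> m"
    have "2 * 1 < real m * p" using m assms(3) by (intro mult_le_less_imp_less) auto
    then show ?Q by (intro main[OF assouad_bound_2]) simp
  qed
qed

end
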